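(* Let $k>1$ be an integer, let $M,N>k$ be integers, let $\alpha>0$, let $y$ be a function on $[0,1]$, and let $\widetilde Y_1,\dots,\widetilde Y_M$ be the group averages of the noisy samples of $y$ as described in the context. Let $\mathcal{H}=\{f\in H^k(0,1): f(0)=y(0),\ f(1)=y(1)\}$ and, for $f\in\mathcal H$, let $$\Phi(f)=\frac1M\sum_{i=1}^M\left(\widetilde Y_i-M_i(f)\right)^2+\alpha\|f^{(k)}\|_{L^2(0,1)}^2 .$$ Then there exists a unique function $f_*\in\mathcal H$ such that $\Phi(f_* )\le\Phi(f)$ for all $f\in\mathcal H$.
   Context: $y=y(x)$ is a real function on $[0,1]$. Put $L=MN$, $\hat x_j=j/L$ for $0\le j\le L$ (uniform grid on $[0,1]$). Noisy samples are real numbers $\widetilde y_j=y(\hat x_j)+\eta_j$, where $\eta_j$ is (a realization of) noise with distribution $\mathcal N(0,\sigma^2)$; the endpoint observations are exact: $\widetilde y_0=y(0)$, $\widetilde y_L=y(1)$. The coarse grid is $x_i=\hat x_{iN}=i/M$, $0\le i\le M$, with mesh size $h_M=1/M$. The group averages are $\widetilde Y_i=\frac1N\sum_{j=1}^N\widetilde y_{(i-1)N+j}$ for $1\le i\le M$. For a function $f$, $M_i(f)=\frac1{h_M}\int_{x_{i-1}}^{x_i}f(x)\,dx$ is its average over $[x_{i-1},x_i]$. $H^k(0,1)$ is the usual Sobolev space of $L^2(0,1)$ functions whose weak derivatives up to order $k$ lie in $L^2(0,1)$; functions in it are identified with their continuous representatives on $[0,1]$. *)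

theory Defs
  imports "HOL-Probability.Probability"
begin

text \<open>The space \<open>L\<^sup>2(0,1)\<close>; its elements are represented by functions, not by classes modulo
  null sets. Values outside \<open>(0,1)\<close> are ignored.\<close>

definition L2_01 :: "(real \<Rightarrow> real) set" where
  "L2_01 = {f. set_borel_measurable lebesgue {0<..<1} f \<and>
               set_integrable lebesgue {0<..<1} (\<lambda>x. (f x)\<^sup>2)}"

definition L2_norm_01 :: "(real \<Rightarrow> real) \<Rightarrow> real" where
  "L2_norm_01 f = sqrt (LINT x:{0<..<1}|lebesgue. (f x)\<^sup>2)"

text \<open>\<open>C\<^sub>c\<^sup>\<infinity>(0,1)\<close>, each function being extended by zero to the whole line.\<close>

definition test_functions_01 :: "(real \<Rightarrow> real) set" where
  "test_functions_01 = {\<phi>. (\<forall>n. (deriv ^^ n) \<phi> differentiable_on UNIV) \<and>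
                            closure {x. \<phi> x \<noteq> 0} \<subseteq> {0<..<1}}"

definition has_weak_deriv_01 :: "nat \<Rightarrow> (real \<Rightarrow> real) \<Rightarrow> (real \<Rightarrow> real) \<Rightarrow> bool" where
  "has_weak_deriv_01 j f g \<longleftrightarrow>
     (\<forall>\<phi>\<in>test_functions_01.
        (LINT x:{0<..<1}|lebesgue. f x * (deriv ^^ j) \<phi> x) =
        (- 1) ^ j * (LINT x:{0<..<1}|lebesgue. g x * \<phi> x))"

text \<open>Weak derivatives are unique only up to null sets, so this picks a representative; it is
  only meant to be used where a square integrable weak derivative exists, and under integrals.\<close>

definition weak_deriv_01 :: "nat \<Rightarrow> (real \<Rightarrow> real) \<Rightarrow> real \<Rightarrow> real" where
  "weak_deriv_01 j f = (SOME g. g \<in> L2_01 \<and> has_weak_deriv_01 j f g)"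

text \<open>\<open>H\<^sup>k(0,1)\<close> for \<open>k \<ge> 1\<close>. An element is represented by its continuous representative on
  \<open>[0,1]\<close>; extensionality (the value \<open>undefined\<close> outside \<open>[0,1]\<close>) makes that representative
  unique as a function on the type \<open>real\<close>, so that equality in this set is equality on
  \<open>[0,1]\<close>.\<close>

definition sobolev_01 :: "nat \<Rightarrow> (real \<Rightarrow> real) set" where
  "sobolev_01 k = {f \<in> extensional {0..1}. continuous_on {0..1} f \<and> f \<in> L2_01 \<and>
                     (\<forall>j\<le>k. \<exists>g\<in>L2_01. has_weak_deriv_01 j f g)}"

text \<open>The law \<open>N(0,\<sigma>\<^sup>2)\<close>, including the degenerate case \<open>\<sigma> = 0\<close>, in which
  \<open>normal_density\<close> is not a probability density.\<close>

definition centered_normal :: "real \<Rightarrow> real measure" where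
  "centered_normal \<sigma> =
     (if \<sigma> = 0 then return borel 0 else density lborel (\<lambda>x. ennreal (normal_density 0 \<sigma> x)))"

definition noisy_sample :: "nat \<Rightarrow> nat \<Rightarrow> (real \<Rightarrow> real) \<Rightarrow> (nat \<Rightarrow> real) \<Rightarrow> nat \<Rightarrow> real" where
  "noisy_sample M N y e j = y (real j / real (M * N)) + e j"

definition group_average :: "nat \<Rightarrow> (nat \<Rightarrow> real) \<Rightarrow> nat \<Rightarrow> real" where
  "group_average N s i = 1 / real N * (\<Sum>j = 1..N. s ((i - 1) * N + j))"

definition cell_average :: "nat \<Rightarrow> (real \<Rightarrow> real) \<Rightarrow> nat \<Rightarrow> real" where
  "cell_average M f i =
     1 / (1 / real M) * (LINT x:{real (i - 1) / real M..real i / real M}|lebesgue. f x)"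

definition admissible :: "nat \<Rightarrow> (real \<Rightarrow> real) \<Rightarrow> (real \<Rightarrow> real) set" where
  "admissible k y = {f \<in> sobolev_01 k. f 0 = y 0 \<and> f 1 = y 1}"

definition Phi :: "nat \<Rightarrow> nat \<Rightarrow> real \<Rightarrow> (nat \<Rightarrow> real) \<Rightarrow> (real \<Rightarrow> real) \<Rightarrow> real" where
  "Phi k M \<alpha> Y f =
     1 / real M * (\<Sum>i = 1..M. (Y i - cell_average M f i)\<^sup>2) +
     \<alpha> * (L2_norm_01 (weak_deriv_01 k f))\<^sup>2"

end

theory Submission
  imports Defs
begin

text \<open>
  By the du Bois-Reymond lemma, the elements of \<open>H\<^sup>k(0,1)\<close> are exactly the functions
  \<open>f = p + I\<^sup>k g\<close> with \<open>p\<close> a polynomial of degree less than \<open>k\<close>, \<open>g \<in> L\<^sup>2\<close> the weak derivative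
  of order \<open>k\<close>, and \<open>I\<close> the integration operator. In these coordinates the cell averages and the
  values at the endpoints are functionals of the form \<open>P\<^sub>i(p) + \<langle>K\<^sub>i, g\<rangle>\<close> with \<open>K\<^sub>i \<in> L\<^sup>2\<close>. Stationarity
  therefore forces \<open>\<alpha> g\<close> to be a combination \<open>\<Sum> w\<^sub>i K\<^sub>i\<close>, and the Euler-Lagrange equations become a
  finite symmetric linear system for the multipliers \<open>w\<^sub>i\<close> and the polynomial \<open>p\<close>. The right-hand
  side vanishes on the kernel of the system, so it is solvable, and no compactness or completeness
  of \<open>L\<^sup>2\<close> is needed. For a solution \<open>f\<^sub>*\<close> and any competitor \<open>h\<close>, the difference
  \<open>\<Phi>(h) - \<Phi>(f\<^sub>*)\<close> is the quadratic part of \<open>\<Phi>\<close> at \<open>h - f\<^sub>*\<close>. It vanishes only if \<open>h - f\<^sub>*\<close> is a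
  polynomial of degree less than \<open>k\<close> with \<open>M > k\<close> zero cell averages, that is, only if \<open>h = f\<^sub>*\<close>.
\<close>

section \<open>Finite systems of linear functionals\<close>

text \<open>Induction on \<open>n\<close>: if \<open>l\<close> does not vanish on the kernel of the
  first \<open>n\<close> functionals, a multiple of \<open>L n\<close> is subtracted from it.
  Closure of \<open>V\<close> is stated only through the values of the functionals, so
  \<open>'v\<close> carries no vector space structure.\<close>

lemma functional_in_span_of_kernels:
  fixes l :: "'v \<Rightarrow> real" and L :: "nat \<Rightarrow> 'v \<Rightarrow> real"
  assumes lin: "\<And>x y a. x \<in> V \<Longrightarrow> y \<in> V \<Longrightarrow>
      \<exists>z\<in>V. l z = l x + a * l y \<and> (\<forall>i<n. L i z = L i x + a * L i y)"
    and ker: "\<And>x. x \<in> V \<Longrightarrow> \<forall>i<n. L i x = 0 \<Longrightarrow> l x = 0"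
  shows "\<exists>d. \<forall>x\<in>V. l x = (\<Sum>i<n. d i * L i x)"
  using assms
proof (induction n arbitrary: l)
  case 0
  then show ?case by simp
next
  case (Suc n)
  show ?case
  proof (cases "\<forall>x\<in>V. (\<forall>i<n. L i x = 0) \<longrightarrow> l x = 0")
    case True
    have "\<exists>z\<in>V. l z = l x + a * l y \<and> (\<forall>i<n. L i z = L i x + a * L i y)"
      if "x \<in> V" "y \<in> V" for x y a
      using Suc.prems(1)[OF that] by (meson less_SucI)
    then obtain d where "\<forall>x\<in>V. l x = (\<Sum>i<n. d i * L i x)"
      using Suc.IH[of l] True by blast
    then have "\<forall>x\<in>V. l x = (\<Sum>i<Suc n. (d(n := 0)) i * L i x)"
      by simp
    then show ?thesis by blast
  next
    case False
    then obtain x0 where x0: "x0 \<in> V" "\<forall>i<n. L i x0 = 0" "l x0 \<noteq> 0" by blast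
    have n0: "L n x0 \<noteq> 0"
      using Suc.prems(2)[OF x0(1)] x0 less_Suc_eq by metis
    \<comment> \<open>This constant makes \<open>l'\<close> vanish at \<open>x0\<close>. A point of
      the kernel of the first \<open>n\<close> functionals can then be shifted along
      \<open>x0\<close> into the kernel of all \<open>Suc n\<close> without changing
      \<open>l'\<close>, and there \<open>l'\<close> equals \<open>l\<close>.\<close>
    define c where "c = l x0 / L n x0"
    define l' where "l' = (\<lambda>x. l x - c * L n x)"
    have "\<exists>z\<in>V. l' z = l' x + a * l' y \<and> (\<forall>i<n. L i z = L i x + a * L i y)"
      if xy: "x \<in> V" "y \<in> V" for x y a
    proof -
      obtain z where "z \<in> V" "l z = l x + a * l y" "\<forall>i<Suc n. L i z = L i x + a * L i y"
        using Suc.prems(1)[OF xy] by blast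
      then show ?thesis
        by (intro bexI[of _ z]) (auto simp: l'_def algebra_simps)
    qed
    moreover have "l' x = 0" if x: "x \<in> V" "\<forall>i<n. L i x = 0" for x
    proof -
      obtain z where z: "z \<in> V" "l z = l x + (- (L n x / L n x0)) * l x0"
          "\<forall>i<Suc n. L i z = L i x + (- (L n x / L n x0)) * L i x0"
        using Suc.prems(1)[OF x(1) x0(1)] by blast
      have "\<forall>i<Suc n. L i z = 0"
        using z(3) x(2) x0(2) n0 by (auto simp: less_Suc_eq)
      then have "l z = 0" using Suc.prems(2) z(1) by blast
      then show ?thesis using z(2) by (simp add: l'_def c_def)
    qed
    ultimately obtain d where d: "\<forall>x\<in>V. l' x = (\<Sum>i<n. d i * L i x)"
      using Suc.IH[of l'] by blast
    have "\<forall>x\<in>V. l x = (\<Sum>i<Suc n. (d(n := c)) i * L i x)"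
    proof
      fix x assume "x \<in> V"
      then have "l x = (\<Sum>i<n. d i * L i x) + c * L n x"
        using d by (force simp: l'_def)
      then show "l x = (\<Sum>i<Suc n. (d(n := c)) i * L i x)" by simp
    qed
    then show ?thesis by blast
  qed
qed

section \<open>Square integrable functions and primitives on the unit interval\<close>

text \<open>As a finite measure it turns set integrals into plain ones, puts L^2 inside L^1 and
  admits Fubini on the unit square.\<close>

definition unit_lebesgue :: "real measure" (\<open>\<mu>\<close>) where
  "\<mu> = lebesgue_on {0<..<1}"

lemma space_mu [simp]: "space \<mu> = {0<..<1}"
  by (simp add: unit_lebesgue_def)

lemma measurable_ident_mu [measurable]: "(\<lambda>x. x) \<in> measurable \<mu> borel"
  unfolding unit_lebesgue_def
  by (rule measurable_restrict_space1) (rule measurable_completion, simp)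

lemma measurable_mu: "f \<in> borel_measurable borel \<Longrightarrow> f \<in> borel_measurable \<mu>"
  using measurable_compose[OF measurable_ident_mu] by blast

lemma finite_measure_mu: "finite_measure \<mu>"
  unfolding unit_lebesgue_def by (rule finite_measure_lebesgue_on) simp

interpretation mu: finite_measure \<mu> by (rule finite_measure_mu)

lemma integral_mu_const [simp]: "(LINT x|\<mu>. (c::real)) = c"
  by (simp add: unit_lebesgue_def measure_restrict_space)

lemma set_integral_unit_interval: "(LINT x:{0<..<1}|lebesgue. f x) = (LINT x|\<mu>. (f x :: real))"
  by (simp add: unit_lebesgue_def set_lebesgue_integral_def integral_restrict_space)

lemma AE_mu_iff: "(AE x in \<mu>. P x) \<longleftrightarrow> (AE x in lebesgue. x \<in> {0<..<1} \<longrightarrow> P x)"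
  unfolding unit_lebesgue_def by (rule AE_restrict_space_iff) simp

lemma AE_mu_neq: "AE x in \<mu>. x \<noteq> (c::real)"
  unfolding AE_mu_iff
  by (rule AE_mp[OF AE_completion[OF AE_lborel_singleton[of c]]]) simp

section \<open>The space L^2(0,1) over \<open>\<mu>\<close>\<close>

lemma L2_01_iff: "f \<in> L2_01 \<longleftrightarrow> f \<in> borel_measurable \<mu> \<and> integrable \<mu> (\<lambda>x. (f x)\<^sup>2)"
  unfolding L2_01_def unit_lebesgue_def set_borel_measurable_def set_integrable_def
  by (simp add: borel_measurable_restrict_space_iff integrable_restrict_space)

lemma L2_01_measurable: "f \<in> L2_01 \<Longrightarrow> f \<in> borel_measurable \<mu>"
  by (simp add: L2_01_iff)

lemma L2_01_square: "f \<in> L2_01 \<Longrightarrow> integrable \<mu> (\<lambda>x. (f x)\<^sup>2)"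
  by (simp add: L2_01_iff)

lemma integrable_mu_bounded:
  fixes f :: "real \<Rightarrow> real"
  assumes "f \<in> borel_measurable \<mu>" "\<And>x. 0 < x \<Longrightarrow> x < 1 \<Longrightarrow> \<bar>f x\<bar> \<le> B"
  shows "integrable \<mu> f"
  by (rule mu.integrable_const_bound[of _ B]) (use assms in \<open>auto intro!: AE_I2\<close>)

lemma L2_01_bounded:
  fixes f :: "real \<Rightarrow> real"
  assumes "f \<in> borel_measurable \<mu>" "\<And>x. 0 < x \<Longrightarrow> x < 1 \<Longrightarrow> \<bar>f x\<bar> \<le> B"
  shows "f \<in> L2_01"
proof -
  have "\<bar>(f x)\<^sup>2\<bar> \<le> B\<^sup>2" if "0 < x" "x < 1" for x
    using power_mono[OF assms(2)[OF that], of 2] by simp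
  then show ?thesis
    using assms(1) by (auto simp: L2_01_iff intro!: integrable_mu_bounded[of _ "B\<^sup>2"])
qed

lemma L2_01_integrable_mult:
  assumes "f \<in> L2_01" "g \<in> L2_01"
  shows "integrable \<mu> (\<lambda>x. f x * g x)"
proof (rule Bochner_Integration.integrable_bound)
  show "integrable \<mu> (\<lambda>x. (f x)\<^sup>2 + (g x)\<^sup>2)"
    by (intro Bochner_Integration.integrable_add L2_01_square assms)
  show "(\<lambda>x. f x * g x) \<in> borel_measurable \<mu>"
    by (intro borel_measurable_times L2_01_measurable assms)
  have "\<bar>f x * g x\<bar> \<le> (f x)\<^sup>2 + (g x)\<^sup>2" for x
    using sum_squares_bound[of "\<bar>f x\<bar>" "\<bar>g x\<bar>"] mult_nonneg_nonneg[of "\<bar>f x\<bar>" "\<bar>g x\<bar>"]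
    unfolding abs_mult power2_abs by linarith
  then show "AE x in \<mu>. norm (f x * g x) \<le> norm ((f x)\<^sup>2 + (g x)\<^sup>2)"
    by (intro AE_I2) (auto intro: order_trans)
qed

lemma L2_01_const [simp, intro]: "(\<lambda>x. c) \<in> L2_01"
  by (rule L2_01_bounded[of _ "\<bar>c\<bar>"]) auto

lemma L2_01_cmult [intro]: "f \<in> L2_01 \<Longrightarrow> (\<lambda>x. c * f x) \<in> L2_01"
  by (auto simp: L2_01_iff power_mult_distrib)

lemma L2_01_add [intro]:
  assumes "f \<in> L2_01" "g \<in> L2_01" shows "(\<lambda>x. f x + g x) \<in> L2_01"
proof -
  have "integrable \<mu> (\<lambda>x. (f x)\<^sup>2 + (g x)\<^sup>2 + 2 * (f x * g x))"
    using assms L2_01_integrable_mult[OF assms]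
    by (intro Bochner_Integration.integrable_add integrable_mult_right) (auto simp: L2_01_iff)
  then show ?thesis
    using assms by (auto simp: L2_01_iff power2_sum algebra_simps)
qed

lemma L2_01_diff [intro]:
  assumes "f \<in> L2_01" "g \<in> L2_01" shows "(\<lambda>x. f x - g x) \<in> L2_01"
  using L2_01_add[OF assms(1) L2_01_cmult[OF assms(2), of "-1"]] by simp

lemma L2_01_sum [intro]:
  assumes "\<And>i. i \<in> A \<Longrightarrow> f i \<in> L2_01" shows "(\<lambda>x. \<Sum>i\<in>A. f i x) \<in> L2_01"
  using assms
  by (induction A rule: infinite_finite_induct) auto

lemma L2_01_integrable: "f \<in> L2_01 \<Longrightarrow> integrable \<mu> f"
  using L2_01_integrable_mult[of f "\<lambda>_. 1"] by simp

lemma L2_01_continuous: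
  assumes "continuous_on {0..1} f" shows "f \<in> L2_01"
proof -
  obtain B where B: "\<And>x. x \<in> {0..1} \<Longrightarrow> \<bar>f x\<bar> \<le> B"
    using compact_imp_bounded[OF compact_continuous_image[OF assms compact_Icc]]
    unfolding bounded_iff by (metis imageI real_norm_def)
  have "f \<in> borel_measurable \<mu>"
    unfolding unit_lebesgue_def
    by (rule continuous_imp_measurable_on_sets_lebesgue[OF continuous_on_subset[OF assms]]) auto
  then show ?thesis by (rule L2_01_bounded[of _ B]) (use B in auto)
qed

text \<open>The cutoff sits in the integrand over a fixed measure, so dominated convergence and
  Fubini apply directly. The function is defined on the whole line and constant on either side of
  \<open>[0,1]\<close>.\<close>

definition primitive_01 :: "(real \<Rightarrow> real) \<Rightarrow> real \<Rightarrow> real" where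
  "primitive_01 g x = (LINT t|\<mu>. (if t < x then g t else 0))"

lemma integrable_mu_cut:
  fixes g :: "real \<Rightarrow> real"
  assumes "integrable \<mu> g"
  shows "integrable \<mu> (\<lambda>t. if t < x then g t else 0)"
  using assms by (auto intro!: Bochner_Integration.integrable_bound[OF assms])

lemma primitive_01_continuous:
  assumes [measurable]: "integrable \<mu> g"
  shows "continuous_on A (primitive_01 g)"
proof -
  have "isCont (primitive_01 g) x" for x
    unfolding continuous_at_sequentially o_def primitive_01_def
  proof (intro allI impI)
    fix u assume u: "u \<longlonglongrightarrow> x"
    show "(\<lambda>n. LINT t|\<mu>. (if t < u n then g t else 0)) \<longlonglongrightarrow> (LINT t|\<mu>. (if t < x then g t else 0))"
    proof (rule integral_dominated_convergence[where w="\<lambda>t. \<bar>g t\<bar>"])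
      show "AE t in \<mu>. (\<lambda>n. if t < u n then g t else 0) \<longlonglongrightarrow> (if t < x then g t else 0)"
        \<comment> \<open>The integrands can fail to converge only at \<open>t = x\<close>, a null
          set.\<close>
        using AE_mu_neq[of x]
      proof eventually_elim
        case (elim t)
        have "\<forall>\<^sub>F n in sequentially. (t < u n) = (t < x)"
        proof (cases "t < x")
          case True
          then show ?thesis using order_tendstoD(1)[OF u] by auto
        next
          case False
          then have "x < t" using elim by simp
          then show ?thesis using order_tendstoD(2)[OF u, of t]
            by (auto elim!: eventually_mono)
        qed
        then show ?case
          by (intro tendsto_eventually) (erule eventually_mono, simp)
      qed
    qed (use assms in auto)
  qed
  then show ?thesis by (simp add: continuous_at_imp_continuous_on)
qed

lemma primitive_01_L2: "integrable \<mu> g \<Longrightarrow> primitive_01 g \<in> L2_01"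
  by (intro L2_01_continuous primitive_01_continuous)

lemma primitive_01_0 [simp]: "primitive_01 g 0 = 0"
  unfolding primitive_01_def
  by (rule integral_eq_zero_AE) (auto intro!: AE_I2)

lemma primitive_01_1 [simp]: "primitive_01 g 1 = (LINT t|\<mu>. g t)"
  unfolding primitive_01_def
  by (rule Bochner_Integration.integral_cong) auto

lemma primitive_01_add:
  "integrable \<mu> f \<Longrightarrow> integrable \<mu> g \<Longrightarrow>
    primitive_01 (\<lambda>t. f t + g t) x = primitive_01 f x + primitive_01 g x"
  unfolding primitive_01_def
  by (subst Bochner_Integration.integral_add[symmetric])
     (auto intro!: integrable_mu_cut Bochner_Integration.integral_cong)

lemma primitive_01_cmult: "primitive_01 (\<lambda>t. c * f t) x = c * primitive_01 f x"
  unfolding primitive_01_def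
  unfolding integral_mult_right_zero[symmetric] by (rule Bochner_Integration.integral_cong) auto

lemma primitive_01_cong_AE:
  assumes "AE t in \<mu>. f t = g t" and [measurable]: "f \<in> borel_measurable \<mu>" "g \<in> borel_measurable \<mu>"
  shows "primitive_01 f x = primitive_01 g x"
  unfolding primitive_01_def
  by (rule integral_cong_AE) (use assms(1) in auto)

text \<open>Fubini for \<open>a x * g t\<close> on the triangle \<open>x \<le> t\<close>:
  integrating in \<open>t\<close> first leaves the total integral of \<open>g\<close> minus its
  primitive, integrating in \<open>x\<close> first leaves the primitive of \<open>a\<close>.\<close>

lemma integral_by_parts_01:
  fixes a g :: "real \<Rightarrow> real"
  assumes a [measurable]: "integrable \<mu> a" and g [measurable]: "integrable \<mu> g"
  shows "(LINT x|\<mu>. a x * primitive_01 g x) + (LINT x|\<mu>. primitive_01 a x * g x)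
       = (LINT x|\<mu>. a x) * (LINT x|\<mu>. g x)"
proof -
  interpret P: pair_sigma_finite \<mu> \<mu>
    by (simp add: pair_sigma_finite_def mu.sigma_finite_measure_axioms)
  define F where "F = (\<lambda>x t. if t < x then 0 else a x * g t)"
  have F [measurable]: "case_prod F \<in> borel_measurable (\<mu> \<Otimes>\<^sub>M \<mu>)"
    unfolding F_def by measurable
  have ag: "integrable (\<mu> \<Otimes>\<^sub>M \<mu>) (\<lambda>(x,t). a x * g t)"
    by (rule P.Fubini_integrable) (use a g in \<open>simp_all add: abs_mult\<close>)
  have "integrable (\<mu> \<Otimes>\<^sub>M \<mu>) (case_prod F)"
    by (rule Bochner_Integration.integrable_bound[OF ag F]) (auto simp: F_def)
  then have swap: "(LINT t|\<mu>. LINT x|\<mu>. F x t) = (LINT x|\<mu>. LINT t|\<mu>. F x t)"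
    by (rule P.Fubini_integral)
  have 1: "(LINT t|\<mu>. F x t) = a x * (LINT t|\<mu>. g t) - a x * primitive_01 g x" for x
  proof -
    have "(LINT t|\<mu>. F x t) = (LINT t|\<mu>. a x * g t - a x * (if t < x then g t else 0))"
      by (rule Bochner_Integration.integral_cong) (auto simp: F_def)
    also have "\<dots> = a x * (LINT t|\<mu>. g t) - a x * primitive_01 g x"
      unfolding primitive_01_def
      by (subst Bochner_Integration.integral_diff) (auto intro!: integrable_mu_cut g)
    finally show ?thesis .
  qed
  have 2: "(LINT x|\<mu>. F x t) = primitive_01 a t * g t" for t
  proof -
    have "(LINT x|\<mu>. F x t) = (LINT x|\<mu>. (if x < t then a x else 0) * g t)"
    proof (rule integral_cong_AE)
      show "AE x in \<mu>. F x t = (if x < t then a x else 0) * g t"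
        using AE_mu_neq[of t] by eventually_elim (auto simp: F_def)
      show "(\<lambda>x. F x t) \<in> borel_measurable \<mu>" unfolding F_def by measurable
    qed measurable
    then show ?thesis by (simp add: primitive_01_def)
  qed
  \<comment> \<open>Fubini also yields integrability of \<open>a x * primitive_01 g x\<close>, by
    reading formula \<open>1\<close> backwards.\<close>
  have "integrable \<mu> (\<lambda>x. LINT t|\<mu>. F x t)"
    using P.integrable_fst'[OF \<open>integrable _ (case_prod F)\<close>] by simp
  then have "integrable \<mu> (\<lambda>x. a x * (LINT t|\<mu>. g t) - (LINT t|\<mu>. F x t))"
    using a by simp
  then have i: "integrable \<mu> (\<lambda>x. a x * primitive_01 g x)"
    by (simp add: 1)
  have "(LINT x|\<mu>. a x * (LINT t|\<mu>. g t) - a x * primitive_01 g x)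
      = (LINT x|\<mu>. a x) * (LINT t|\<mu>. g t) - (LINT x|\<mu>. a x * primitive_01 g x)"
    by (subst Bochner_Integration.integral_diff) (use i a in auto)
  then show ?thesis using swap unfolding 1 2 by simp
qed

section \<open>Smooth bumps and test functions\<close>

definition smooth_real :: "(real \<Rightarrow> real) set" where
  "smooth_real = {f. \<forall>n. (deriv ^^ n) f differentiable_on UNIV}"

text \<open>Smoothness follows from membership in a class closed under differentiation, which avoids
  formulas for n-th derivatives.\<close>

lemma smooth_real_coinduct:
  assumes "f \<in> X" "\<And>f. f \<in> X \<Longrightarrow> f differentiable_on UNIV" "\<And>f. f \<in> X \<Longrightarrow> deriv f \<in> X"
  shows "f \<in> smooth_real"
proof -
  have "(deriv ^^ n) f \<in> X" for n
    by (induction n) (use assms in auto)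
  then show ?thesis using assms(2) by (auto simp: smooth_real_def)
qed

lemma smooth_real_deriv:
  assumes "f \<in> smooth_real"
  shows "(f has_real_derivative deriv f x) (at x)" "deriv f \<in> smooth_real"
proof -
  have "(deriv ^^ 0) f differentiable_on UNIV"
    using assms unfolding smooth_real_def by blast
  then show "(f has_real_derivative deriv f x) (at x)"
    by (simp add: DERIV_deriv_iff_real_differentiable differentiable_on_eq_differentiable_at)
  have "(deriv ^^ Suc n) f differentiable_on UNIV" for n
    using assms unfolding smooth_real_def by blast
  then show "deriv f \<in> smooth_real"
    by (simp add: smooth_real_def funpow_swap1)
qed

lemma smooth_real_antideriv:
  assumes "\<And>x. (F has_real_derivative f x) (at x)" "f \<in> smooth_real"
  shows "F \<in> smooth_real" "deriv F = f"
proof -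
  show eq: "deriv F = f" using assms(1) by (auto intro: DERIV_imp_deriv)
  have "(deriv ^^ n) F differentiable_on UNIV" for n
  proof (cases n)
    case 0
    then show ?thesis using assms(1)
      by (auto simp: differentiable_on_eq_differentiable_at real_differentiable_def)
  next
    case (Suc m)
    then show ?thesis using assms(2) by (simp add: smooth_real_def funpow_swap1 eq)
  qed
  then show "F \<in> smooth_real" by (simp add: smooth_real_def)
qed

text \<open>The classical flat function \<open>exp (- \<epsilon> / s)\<close> extended by zero,
  times a polynomial in \<open>1 / s\<close> so that the family is closed under
  differentiation.\<close>

definition flat :: "real \<Rightarrow> real poly \<Rightarrow> real \<Rightarrow> real" where
  "flat \<epsilon> p s = (if s > 0 then poly p (1 / s) * exp (- \<epsilon> / s) else 0)"

lemma poly_times_exp_tendsto_0: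
  fixes \<epsilon> :: real
  assumes "\<epsilon> > 0"
  shows "((\<lambda>t. poly p t * exp (- \<epsilon> * t)) \<longlongrightarrow> 0) at_top"
proof -
  have "((\<lambda>t. t ^ i * exp (- \<epsilon> * t)) \<longlongrightarrow> 0) at_top" for i
  proof -
    have "((\<lambda>t. (1 / \<epsilon> ^ i) * ((\<epsilon> * t) ^ i / exp (\<epsilon> * t))) \<longlongrightarrow> (1 / \<epsilon> ^ i) * 0) at_top"
      by (intro tendsto_intros filterlim_compose[OF tendsto_power_div_exp_0]
          filterlim_tendsto_pos_mult_at_top[OF tendsto_const assms filterlim_ident])
    moreover have "(1 / \<epsilon> ^ i) * ((\<epsilon> * t) ^ i / exp (\<epsilon> * t)) = t ^ i * exp (- \<epsilon> * t)" for t
      using assms by (simp add: power_mult_distrib exp_minus field_simps)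
    ultimately show ?thesis by simp
  qed
  then have "((\<lambda>t. \<Sum>i\<le>degree p. coeff p i * (t ^ i * exp (- \<epsilon> * t))) \<longlongrightarrow> (\<Sum>i\<le>degree p. coeff p i * 0)) at_top"
    by (intro tendsto_intros)
  then show ?thesis by (simp add: poly_altdef sum_distrib_right mult.assoc)
qed

lemma flat_tendsto_0:
  assumes "\<epsilon> > 0"
  shows "(flat \<epsilon> p \<longlongrightarrow> 0) (at 0)"
proof -
  have "(flat \<epsilon> p \<longlongrightarrow> 0) (at_left 0)"
    by (rule tendsto_eventually) (auto simp: flat_def eventually_at_left_field intro!: exI[of _ "-1"])
  moreover have "(flat \<epsilon> p \<longlongrightarrow> 0) (at_right 0)"
    unfolding filterlim_at_right_to_top
  proof (rule Lim_transform_eventually[OF poly_times_exp_tendsto_0[OF assms, of p]])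
    show "\<forall>\<^sub>F t in at_top. poly p t * exp (- \<epsilon> * t) = flat \<epsilon> p (inverse t)"
      using eventually_gt_at_top[of 0] by eventually_elim (simp add: flat_def field_simps)
  qed
  ultimately show ?thesis by (simp add: filterlim_split_at)
qed

text \<open>With \<open>t = 1 / s\<close> one has d/ds = - t^2 d/dt, whence the polynomial t^2
  (\<epsilon> p - p'). At \<open>s = 0\<close> the difference quotient is the member of the family
  belonging to t p(t), which tends to 0.\<close>

lemma flat_has_derivative:
  assumes "\<epsilon> > 0"
  shows "(flat \<epsilon> p has_real_derivative
           flat \<epsilon> (smult \<epsilon> (p * [:0, 0, 1:]) - pderiv p * [:0, 0, 1:]) s) (at s)"
proof (cases s "0 :: real" rule: linorder_cases)
  case less
  have "((\<lambda>x. 0) has_real_derivative 0) (at s)" by simp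
  then have "(flat \<epsilon> p has_real_derivative 0) (at s)"
    by (rule has_field_derivative_transform_within_open[of _ _ _ "{..<0}"])
       (use less in \<open>auto simp: flat_def\<close>)
  then show ?thesis using less by (simp add: flat_def)
next
  case equal
  have "((\<lambda>h. (flat \<epsilon> p (0 + h) - flat \<epsilon> p 0) / h) \<longlongrightarrow> 0) (at 0)"
  proof (rule Lim_transform_eventually[OF flat_tendsto_0[OF assms, of "pCons 0 p"]])
    show "\<forall>\<^sub>F h in at 0. flat \<epsilon> (pCons 0 p) h = (flat \<epsilon> p (0 + h) - flat \<epsilon> p 0) / h"
      by (auto simp: flat_def intro!: always_eventually)
  qed
  then show ?thesis using equal by (simp add: DERIV_def flat_def)
next
  case greater
  have "((\<lambda>x. poly p (1 / x) * exp (- \<epsilon> / x)) has_real_derivative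
     (poly (pderiv p) (1 / s) * (- 1 / s\<^sup>2)) * exp (- \<epsilon> / s)
      + poly p (1 / s) * (exp (- \<epsilon> / s) * (\<epsilon> / s\<^sup>2))) (at s)"
    using greater
    by (auto intro!: derivative_eq_intros DERIV_chain2[OF poly_DERIV] simp: power2_eq_square)
  then have "(flat \<epsilon> p has_real_derivative
     (poly (pderiv p) (1 / s) * (- 1 / s\<^sup>2)) * exp (- \<epsilon> / s)
      + poly p (1 / s) * (exp (- \<epsilon> / s) * (\<epsilon> / s\<^sup>2))) (at s)"
    by (rule has_field_derivative_transform_within_open[of _ _ _ "{0<..}"])
       (use greater in \<open>auto simp: flat_def\<close>)
  then show ?thesis using greater
    by (simp add: flat_def power2_eq_square field_simps)
qed

text \<open>The factor \<open>r\<close> absorbs the chain rule factor a + b - 2x, and closure under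
  sums absorbs the product rule, so derivatives stay in the class.\<close>

inductive_set bump_class :: "(real \<Rightarrow> real) set" where
  base: "\<epsilon> > 0 \<Longrightarrow> (\<lambda>x. poly r x * flat \<epsilon> p ((x - a) * (b - x))) \<in> bump_class"
| add: "f \<in> bump_class \<Longrightarrow> g \<in> bump_class \<Longrightarrow> (\<lambda>x. f x + g x) \<in> bump_class"

lemma bump_class_deriv:
  assumes "f \<in> bump_class"
  shows "\<exists>f'\<in>bump_class. \<forall>x. (f has_real_derivative f' x) (at x)"
  using assms
proof induction
  case (base \<epsilon> r p a b)
  define q where "q = smult \<epsilon> (p * [:0, 0, 1:]) - pderiv p * [:0, 0, 1:]"
  let ?w = "\<lambda>x. (x - a) * (b - x)"
  define f' where "f' = (\<lambda>x. poly (pderiv r) x * flat \<epsilon> p (?w x)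
      + poly (r * [:a + b, -2:]) x * flat \<epsilon> q (?w x))"
  have "f' \<in> bump_class" unfolding f'_def
    by (intro bump_class.intros base)
  moreover have "((\<lambda>x. poly r x * flat \<epsilon> p (?w x)) has_real_derivative f' x) (at x)" for x
  proof -
    have "(?w has_real_derivative a + b - 2 * x) (at x)"
      by (auto intro!: derivative_eq_intros)
    then have "((\<lambda>x. flat \<epsilon> p (?w x)) has_real_derivative flat \<epsilon> q (?w x) * (a + b - 2 * x)) (at x)"
      unfolding q_def by (rule DERIV_chain2[OF flat_has_derivative[OF base]])
    then show ?thesis
      unfolding f'_def
      by (auto intro!: derivative_eq_intros poly_DERIV simp: algebra_simps)
  qed
  ultimately show ?case by blast
next
  case (add f g)
  then obtain f' g' where "f' \<in> bump_class" "g' \<in> bump_class"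
    "\<And>x. (f has_real_derivative f' x) (at x)" "\<And>x. (g has_real_derivative g' x) (at x)" by blast
  then show ?case
    by (intro bexI[of _ "\<lambda>x. f' x + g' x"]) (auto intro: DERIV_add bump_class.intros)
qed

lemma bump_class_smooth: "f \<in> bump_class \<Longrightarrow> f \<in> smooth_real"
proof (rule smooth_real_coinduct)
  fix f :: "real \<Rightarrow> real" assume "f \<in> bump_class"
  then obtain f' where f': "f' \<in> bump_class" "\<And>x. (f has_real_derivative f' x) (at x)"
    using bump_class_deriv by blast
  then show "f differentiable_on UNIV"
    by (auto simp: differentiable_on_eq_differentiable_at real_differentiable_def)
  have "deriv f = f'" using f'(2) by (auto intro: DERIV_imp_deriv)
  then show "deriv f \<in> bump_class" using f' by simp
qed

text \<open>As \<open>\<epsilon>\<close> tends to 0 these functions converge boundedly to the indicator of \<open>(a,b)\<close>; testing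
  against them therefore gives integrals over intervals without mollification.\<close>

definition bump :: "real \<Rightarrow> real \<Rightarrow> real \<Rightarrow> real \<Rightarrow> real" where
  "bump \<epsilon> a b x = flat \<epsilon> 1 ((x - a) * (b - x))"

lemma bump_bounds: "\<epsilon> > 0 \<Longrightarrow> 0 \<le> bump \<epsilon> a b x" "\<epsilon> > 0 \<Longrightarrow> bump \<epsilon> a b x \<le> 1"
  by (auto simp: bump_def flat_def)

lemma bump_outside: "a \<le> b \<Longrightarrow> x \<notin> {a<..<b} \<Longrightarrow> bump \<epsilon> a b x = 0"
  by (auto simp: bump_def flat_def zero_less_mult_iff)

lemma cmult_bump_in_bump_class: "\<epsilon> > 0 \<Longrightarrow> (\<lambda>x. c * bump \<epsilon> a b x) \<in> bump_class"
  using bump_class.base[of \<epsilon> "[:c:]" 1 a b] by (simp add: bump_def)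

lemma bump_tendsto_indicator:
  assumes "a < b"
  shows "(\<lambda>n. bump (1 / real (Suc n)) a b x) \<longlonglongrightarrow> indicator {a<..<b} x"
proof (cases "x \<in> {a<..<b}")
  case True
  then have w: "(x - a) * (b - x) > 0" by simp
  have "(\<lambda>n. exp (- (1 / real (Suc n)) / ((x - a) * (b - x)))) \<longlonglongrightarrow> exp (- 0 / ((x - a) * (b - x)))"
    by (intro tendsto_intros LIMSEQ_Suc[OF lim_1_over_n]) (use w in force)
  then show ?thesis using True w by (simp add: bump_def flat_def)
next
  case False
  then show ?thesis using bump_outside[of a b x] assms by simp
qed

section \<open>Test functions and their antiderivatives\<close>

lemma smooth_real_continuous: "f \<in> smooth_real \<Longrightarrow> continuous_on A f"
  by (meson DERIV_continuous_on has_field_derivative_at_within smooth_real_deriv(1))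

lemma smooth_real_L2: "f \<in> smooth_real \<Longrightarrow> f \<in> L2_01"
  by (intro L2_01_continuous smooth_real_continuous)

lemma test_functions_01_iff:
  "\<phi> \<in> test_functions_01 \<longleftrightarrow> \<phi> \<in> smooth_real \<and> closure {x. \<phi> x \<noteq> 0} \<subseteq> {0<..<1}"
  by (simp add: test_functions_01_def smooth_real_def)

lemma test_functions_01I:
  assumes "\<phi> \<in> smooth_real" "0 < a" "b < 1" "\<And>x. x \<notin> {a..b} \<Longrightarrow> \<phi> x = 0"
  shows "\<phi> \<in> test_functions_01"
proof -
  have "closure {x. \<phi> x \<noteq> 0} \<subseteq> {a..b}"
    by (rule closure_minimal) (use assms(4) in blast, simp)
  also have "\<dots> \<subseteq> {0<..<1}" using assms(2,3) by auto
  finally show ?thesis using assms(1) by (simp add: test_functions_01_iff)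
qed

lemma test_functions_01_outside:
  "\<phi> \<in> test_functions_01 \<Longrightarrow> x \<notin> {0<..<1} \<Longrightarrow> \<phi> x = 0"
  using closure_subset[of "{x. \<phi> x \<noteq> 0}"] by (auto simp: test_functions_01_iff)

lemma deriv_test_function:
  assumes "\<phi> \<in> test_functions_01" shows "deriv \<phi> \<in> test_functions_01"
proof -
  have "deriv \<phi> x = 0" if "x \<notin> closure {x. \<phi> x \<noteq> 0}" for x
  proof -
    have "((\<lambda>x. 0) has_real_derivative 0) (at x)" by simp
    then have "(\<phi> has_real_derivative 0) (at x)"
      by (rule has_field_derivative_transform_within_open[of _ _ _ "- closure {x. \<phi> x \<noteq> 0}"])
         (use that closure_subset[of "{x. \<phi> x \<noteq> 0}"] in auto)
    then show ?thesis by (rule DERIV_imp_deriv)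
  qed
  then have "closure {x. deriv \<phi> x \<noteq> 0} \<subseteq> closure {x. \<phi> x \<noteq> 0}"
    by (intro closure_minimal) auto
  then show ?thesis using assms by (auto simp: test_functions_01_iff smooth_real_deriv)
qed

lemma higher_deriv_test_function:
  "\<phi> \<in> test_functions_01 \<Longrightarrow> (deriv ^^ n) \<phi> \<in> test_functions_01"
  by (induction n) (auto intro: deriv_test_function)

lemma bump_test_function:
  assumes "\<epsilon> > 0" "0 < a" "a \<le> b" "b < 1"
  shows "bump \<epsilon> a b \<in> test_functions_01"
  by (rule test_functions_01I[of _ a b])
     (use assms bump_class_smooth[OF cmult_bump_in_bump_class[of \<epsilon> 1 a b]] bump_outside[of a b]
      in auto)

lemma primitive_01_eq_integral:
  assumes "continuous_on {0..1} h" "0 \<le> x" "x \<le> 1"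
  shows "primitive_01 h x = integral {0..x} h"
proof -
  have "set_integrable lebesgue {0..1} h"
    using absolutely_integrable_continuous_real[OF assms(1)] .
  then have "set_integrable lebesgue {0<..<x} h"
    by (rule set_integrable_subset) (use assms in auto)
  then have "(LINT t:{0<..<x}|lebesgue. h t) = integral {0<..<x} h"
    by (rule set_lebesgue_integral_eq_integral)
  moreover have "primitive_01 h x = (LINT t:{0<..<x}|lebesgue. h t)"
    unfolding primitive_01_def set_integral_unit_interval[symmetric] set_lebesgue_integral_def
    by (rule Bochner_Integration.integral_cong) (use assms in \<open>auto simp: indicator_def\<close>)
  ultimately show ?thesis by (simp add: integral_open_interval_real)
qed

lemma primitive_01_FTC:
  assumes "\<And>x. x \<in> {0..1} \<Longrightarrow> (F has_real_derivative h x) (at x)" "continuous_on {0..1} h"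
    "0 \<le> x" "x \<le> 1"
  shows "primitive_01 h x = F x - F 0"
proof -
  have "(h has_integral F x - F 0) {0..x}"
    by (rule fundamental_theorem_of_calculus)
       (use assms in \<open>auto simp flip: has_real_derivative_iff_has_vector_derivative
          intro: has_field_derivative_at_within\<close>)
  then show ?thesis using primitive_01_eq_integral[OF assms(2-4)] by (simp add: integral_unique)
qed

lemma primitive_deriv_test_function:
  assumes "\<phi> \<in> test_functions_01" "0 \<le> x" "x \<le> 1"
  shows "primitive_01 (deriv \<phi>) x = \<phi> x"
  using primitive_01_FTC[of \<phi> "deriv \<phi>" x] assms smooth_real_deriv[of \<phi>]
    smooth_real_continuous[of "deriv \<phi>"] test_functions_01_outside[of \<phi> 0]
  by (auto simp: test_functions_01_iff)

text \<open>Left of the support the primitive of \<open>\<psi>\<close> is zero; right of it the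
  primitive equals the total integral, which vanishes by assumption. The primitive is therefore
  compactly supported again.\<close>

lemma antideriv_test_function:
  assumes "\<psi> \<in> smooth_real" "0 < a" "b < 1" "\<And>x. x \<notin> {a..b} \<Longrightarrow> \<psi> x = 0"
    and "(LINT x|\<mu>. \<psi> x) = 0"
  shows "\<exists>\<phi>\<in>test_functions_01. deriv \<phi> = \<psi>"
proof -
  define \<phi> where "\<phi> = primitive_01 \<psi>"
  have c: "continuous_on A \<psi>" for A using assms(1) by (rule smooth_real_continuous)
  have out: "\<phi> x = 0" if "x \<notin> {a..b}" for x
  proof (cases "x < a")
    case True
    then show ?thesis unfolding \<phi>_def primitive_01_def
      by (intro integral_eq_zero_AE AE_I2) (use assms(4) in auto)
  next
    case False
    then have "primitive_01 \<psi> x = (LINT x|\<mu>. \<psi> x)"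
      unfolding primitive_01_def
      by (intro Bochner_Integration.integral_cong) (use that assms(4) in auto)
    then show ?thesis using assms(5) by (simp add: \<phi>_def)
  qed
  have "(\<phi> has_real_derivative \<psi> x) (at x)" for x
  proof (cases "x \<in> {a..b}")
    case True
    have "((\<lambda>x. integral {0..x} \<psi>) has_real_derivative \<psi> x) (at x within {0..1})"
      by (rule integral_has_real_derivative) (use True assms c in auto)
    then have "((\<lambda>x. integral {0..x} \<psi>) has_real_derivative \<psi> x) (at x)"
      using True assms by (simp add: at_within_Icc_at)
    then show ?thesis
      by (rule has_field_derivative_transform_within_open[of _ _ _ "{0<..<1}"])
         (use True assms(2,3) primitive_01_eq_integral[OF c] in \<open>auto simp: \<phi>_def\<close>)
  next
    case False
    have "((\<lambda>x. 0) has_real_derivative 0) (at x)" by simp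
    then have "(\<phi> has_real_derivative 0) (at x)"
      by (rule has_field_derivative_transform_within_open[of _ _ _ "- {a..b}"])
         (use False out in auto)
    then show ?thesis using False assms(4) by simp
  qed
  from smooth_real_antideriv[OF this assms(1)] show ?thesis
    using test_functions_01I[of \<phi> a b] out assms(2,3) by blast
qed

section \<open>Weak derivatives\<close>

text \<open>Differences of primitives are integrals over intervals. Their vanishing passes to Borel
  sets by set induction and to Lebesgue sets by modification on null sets, and integrals over all
  measurable sets determine a function almost everywhere.\<close>

lemma AE_zero_if_primitive_01_zero:
  assumes v: "integrable \<mu> v" and zero: "\<And>x. primitive_01 v x = 0"
  shows "AE x in \<mu>. v x = 0"
proof -
  define w where "w = (\<lambda>x. indicator {0<..<1} x * v x)"
  have w [measurable]: "integrable lebesgue w"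
    using v unfolding unit_lebesgue_def w_def by (simp add: integrable_restrict_space)
  have mu: "(LINT t|lebesgue. w t * indicator A t) = (LINT t|\<mu>. v t * indicator A t)" for A :: "real set"
    unfolding unit_lebesgue_def w_def by (simp add: integral_restrict_space mult.assoc)
  have int: "integrable lebesgue (\<lambda>t. w t * indicator A t)" if "A \<in> sets lebesgue" for A
    using integrable_mult_indicator[OF that w] by (simp add: mult.commute)
  have interval: "(LINT t|lebesgue. w t * indicator {a..b} t) = 0" if "a \<le> b" for a b
  proof -
    have "(LINT t|\<mu>. v t * indicator {a..b} t)
        = (LINT t|\<mu>. (if t < b then v t else 0) - (if t < a then v t else 0))"
    proof (rule integral_cong_AE)
      show "AE t in \<mu>. v t * indicator {a..b} t = (if t < b then v t else 0) - (if t < a then v t else 0)"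
        using AE_mu_neq[of b] by eventually_elim (use that in \<open>auto simp: indicator_def\<close>)
    qed (use v in measurable)
    also have "\<dots> = primitive_01 v b - primitive_01 v a"
      unfolding primitive_01_def
      by (intro Bochner_Integration.integral_diff integrable_mu_cut v)
    finally show ?thesis using zero by (simp add: mu)
  qed
  \<comment> \<open>The integral over the whole line serves the complement case of the
    induction.\<close>
  have UNIV: "(LINT t|lebesgue. w t) = 0"
    using mu[of UNIV] zero[of 1] by simp
  have borel: "(LINT t|lebesgue. w t * indicator A t) = 0" if "A \<in> sets borel" for A
    using that
  proof (induction rule: borel_set_induct)
    case (compl A)
    have "(LINT t|lebesgue. w t * indicator (- A) t) = (LINT t|lebesgue. w t - w t * indicator A t)"
      by (rule Bochner_Integration.integral_cong) (auto simp: indicator_def)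
    also have "\<dots> = 0"
      using compl int[of A] by (subst Bochner_Integration.integral_diff) (auto simp: w UNIV)
    finally show ?case .
  next
    case (union A)
    have A: "A i \<in> sets lebesgue" for i using union.hyps(2) by auto
    have "(LINT t:(\<Union>i. A i)|lebesgue. w t) = (\<Sum>i. LINT t:A i|lebesgue. w t)"
    proof (rule lebesgue_integral_countable_add)
      show "A i \<inter> A j = {}" if "i \<noteq> j" for i j
        using union.hyps(1) that by (simp add: disjoint_family_on_def)
      show "set_integrable lebesgue (\<Union>i. A i) w"
        unfolding set_integrable_def
        by (rule integrable_mult_indicator[OF _ w]) (use A in blast)
    qed (rule A)
    then show ?case
      using union.IH by (simp add: set_lebesgue_integral_def mult.commute)
  qed (use interval in auto)
  have "AE x in lebesgue. w x = 0"
  proof (rule density_unique_real[OF w integrable_zero])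
    fix A :: "real set" assume "A \<in> sets lebesgue"
    then obtain S N N' where A: "A = S \<union> N" "N \<subseteq> N'" "N' \<in> null_sets lborel" "S \<in> sets lborel"
      by (rule sets_completionE)
    have [measurable]: "A \<in> sets lebesgue" "S \<in> sets lebesgue"
      using \<open>A \<in> sets lebesgue\<close> A(4) by auto
    have "AE t in lebesgue. t \<notin> N'"
      using A(3) by (intro AE_completion AE_not_in)
    then have "AE t in lebesgue. w t * indicator A t = w t * indicator S t"
      by eventually_elim (use A(1,2) in \<open>auto simp: indicator_def\<close>)
    then have "(LINT t|lebesgue. w t * indicator A t) = (LINT t|lebesgue. w t * indicator S t)"
      by (intro integral_cong_AE) measurable
    then show "(LINT t:A|lebesgue. w t) = (LINT t:A|lebesgue. 0)"
      using borel[of S] A(4) by (simp add: set_lebesgue_integral_def mult.commute)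
  qed
  then show ?thesis unfolding AE_mu_iff w_def by (auto elim!: eventually_mono)
qed

text \<open>As \<epsilon> tends to 0, orthogonality becomes vanishing of the integral over
  \<open>(a,b)\<close>, so the primitive of \<open>v\<close> is constant on (0,1). Continuity and
  the value 0 at 0 then make it vanish identically.\<close>

lemma AE_zero_if_orthogonal_to_bumps:
  assumes v [measurable]: "integrable \<mu> v"
    and orth: "\<And>\<epsilon> a b. \<lbrakk>\<epsilon> > 0; 0 < a; a < b; b < 1\<rbrakk> \<Longrightarrow> (LINT x|\<mu>. v x * bump \<epsilon> a b x) = 0"
  shows "AE x in \<mu>. v x = 0"
proof -
  have eq: "primitive_01 v b = primitive_01 v a" if ab: "0 < a" "a < b" "b < 1" for a b
  proof -
    have "(\<lambda>n. LINT x|\<mu>. v x * bump (1 / real (Suc n)) a b x)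
      \<longlonglongrightarrow> (LINT x|\<mu>. v x * indicator {a<..<b} x)"
    proof (rule integral_dominated_convergence[where w="\<lambda>x. \<bar>v x\<bar>"])
      show "(\<lambda>x. v x * bump (1 / real (Suc n)) a b x) \<in> borel_measurable \<mu>" for n
        using bump_class_smooth[OF cmult_bump_in_bump_class[of "1 / real (Suc n)" 1 a b]]
        by (intro borel_measurable_times borel_measurable_integrable[OF v] L2_01_measurable
            smooth_real_L2) simp
      show "AE x in \<mu>. norm (v x * bump (1 / real (Suc n)) a b x) \<le> \<bar>v x\<bar>" for n
        using bump_bounds[of "1 / real (Suc n)" a b] by (auto simp: abs_mult intro!: mult_left_le)
      show "AE x in \<mu>. (\<lambda>n. v x * bump (1 / real (Suc n)) a b x) \<longlonglongrightarrow> v x * indicator {a<..<b} x"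
        using bump_tendsto_indicator[OF ab(2)] by (auto intro!: tendsto_mult_left)
    qed (use v in \<open>auto intro!: integrable_abs\<close>)
    then have "(LINT x|\<mu>. v x * indicator {a<..<b} x) = 0"
      using orth[OF _ ab] by (simp add: LIMSEQ_const_iff)
    moreover have "(LINT t|\<mu>. (if t < b then v t else 0) - (if t < a then v t else 0))
        = (LINT x|\<mu>. v x * indicator {a<..<b} x)"
    proof (rule integral_cong_AE)
      show "AE t in \<mu>. (if t < b then v t else 0) - (if t < a then v t else 0) = v t * indicator {a<..<b} t"
        using AE_mu_neq[of a] by eventually_elim (use ab in \<open>auto simp: indicator_def\<close>)
    qed measurable
    moreover have "(LINT t|\<mu>. (if t < b then v t else 0) - (if t < a then v t else 0))
        = primitive_01 v b - primitive_01 v a"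
      unfolding primitive_01_def
      by (intro Bochner_Integration.integral_diff integrable_mu_cut v)
    ultimately show ?thesis by simp
  qed
  have half: "primitive_01 v x = primitive_01 v (1/2)" if "x \<in> {0<..<1}" for x
  proof (cases x "1/2 :: real" rule: linorder_cases)
    case less
    then show ?thesis using eq[of x "1/2"] that by simp
  next
    case equal
    then show ?thesis by (simp only:)
  next
    case greater
    then show ?thesis using eq[of "1/2" x] that by simp
  qed
  have const: "primitive_01 v x = primitive_01 v (1/2)" if "x \<in> {0..1}" for x
    by (rule continuous_constant_on_closure[where S="{0<..<1}", OF primitive_01_continuous[OF v] half])
       (use that in simp_all)
  have "primitive_01 v x = 0" for x
  proof -
    consider "x < 0" | "x \<in> {0..1}" | "x > 1" by force
    then show ?thesis
    proof cases
      case 1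
      then show ?thesis unfolding primitive_01_def
        by (intro integral_eq_zero_AE AE_I2) auto
    next
      case 2
      then show ?thesis using const[of 0] const[of x] by simp
    next
      case 3
      then have "primitive_01 v x = primitive_01 v 1" unfolding primitive_01_def
        by (intro Bochner_Integration.integral_cong) auto
      then show ?thesis using const[of 0] const[of 1] by simp
    qed
  qed
  then show ?thesis by (rule AE_zero_if_primitive_01_zero[OF v])
qed

lemma test_function_L2: "\<phi> \<in> test_functions_01 \<Longrightarrow> \<phi> \<in> L2_01"
  by (simp add: test_functions_01_iff smooth_real_L2)

text \<open>A bump corrected by a multiple of one fixed bump has mean zero and hence is the
  derivative of a test function. So \<open>u\<close> minus a suitable constant is orthogonal to
  every bump.\<close>

lemma du_Bois_Reymond_01:
  assumes u: "u \<in> L2_01"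
    and orth: "\<And>\<phi>. \<phi> \<in> test_functions_01 \<Longrightarrow> (LINT x|\<mu>. u x * deriv \<phi> x) = 0"
  shows "\<exists>c. AE x in \<mu>. u x = c"
proof -
  \<comment> \<open>If every bump had integral zero, the constant 1 would be orthogonal to all bumps
    and hence vanish almost everywhere.\<close>
  have "\<exists>\<epsilon> a b. \<epsilon> > 0 \<and> 0 < a \<and> a < b \<and> b < 1 \<and> (LINT x|\<mu>. bump \<epsilon> a b x) \<noteq> 0"
  proof (rule ccontr)
    assume "\<not> ?thesis"
    then have "AE x in \<mu>. (1::real) = 0"
      by (intro AE_zero_if_orthogonal_to_bumps) auto
    then have "(LINT x|\<mu>. (1::real)) = (LINT x|\<mu>. 0)"
      by (intro integral_cong_AE) auto
    then show False by (simp only: integral_mu_const)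
  qed
  then obtain \<delta> a0 b0 where 0: "\<delta> > 0" "0 < a0" "a0 < b0" "b0 < 1"
    and T0: "(LINT x|\<mu>. bump \<delta> a0 b0 x) \<noteq> 0" by blast
  define T where "T = (LINT x|\<mu>. bump \<delta> a0 b0 x)"
  \<comment> \<open>The average of \<open>u\<close> weighted by the fixed bump, the only possible
    value of the constant.\<close>
  define c where "c = (LINT x|\<mu>. u x * bump \<delta> a0 b0 x) / T"
  have L2: "bump \<epsilon> a b \<in> L2_01" if "\<epsilon> > 0" "0 < a" "a < b" "b < 1" for \<epsilon> a b
    using bump_test_function[of \<epsilon> a b] that by (intro test_function_L2) simp
  have "AE x in \<mu>. u x - c = 0"
  proof (rule AE_zero_if_orthogonal_to_bumps)
    show "integrable \<mu> (\<lambda>x. u x - c)"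
      using L2_01_integrable[OF u] by simp
    fix \<epsilon> a b :: real assume ab: "\<epsilon> > 0" "0 < a" "a < b" "b < 1"
    define B where "B = (LINT x|\<mu>. bump \<epsilon> a b x)"
    \<comment> \<open>The crossed factors \<open>T\<close> and \<open>- B\<close> give mean
      zero.\<close>
    define \<psi> where "\<psi> = (\<lambda>x. T * bump \<epsilon> a b x + (- B) * bump \<delta> a0 b0 x)"
    note i = L2_01_integrable[OF L2[OF ab]] L2_01_integrable[OF L2[OF 0]]
      L2_01_integrable_mult[OF u L2[OF ab]] L2_01_integrable_mult[OF u L2[OF 0]]
    have "\<psi> \<in> smooth_real"
      unfolding \<psi>_def
      by (intro bump_class_smooth bump_class.add cmult_bump_in_bump_class ab 0)
    moreover have "(LINT x|\<mu>. \<psi> x) = 0"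
      unfolding \<psi>_def using i by (simp add: B_def T_def)
    moreover have "\<psi> x = 0" if "x \<notin> {min a a0..max b b0}" for x
    proof -
      have "x \<notin> {a<..<b}" "x \<notin> {a0<..<b0}" using that by auto
      then show ?thesis using bump_outside[of a b x] bump_outside[of a0 b0 x] ab 0
        by (simp add: \<psi>_def)
    qed
    ultimately obtain \<phi> where "\<phi> \<in> test_functions_01" "deriv \<phi> = \<psi>"
      using antideriv_test_function[of \<psi> "min a a0" "max b b0"] ab 0 by auto
    then have "0 = (LINT x|\<mu>. u x * \<psi> x)" using orth by force
    also have "\<dots> = (LINT x|\<mu>. T * (u x * bump \<epsilon> a b x) - B * (u x * bump \<delta> a0 b0 x))"
      by (simp add: \<psi>_def algebra_simps)
    also have "\<dots> = T * (LINT x|\<mu>. u x * bump \<epsilon> a b x) - B * (T * c)"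
      using i T0 by (simp add: c_def T_def)
    finally have "(LINT x|\<mu>. u x * bump \<epsilon> a b x) - c * B = 0"
      using T0 by (simp add: T_def)
    then show "(LINT x|\<mu>. (u x - c) * bump \<epsilon> a b x) = 0"
      using i by (simp add: left_diff_distrib B_def)
  qed
  then show ?thesis by (intro exI[of _ c]) simp
qed

section \<open>Weak derivatives and primitives\<close>

lemma has_weak_deriv_01_iff:
  "has_weak_deriv_01 j f g \<longleftrightarrow> (\<forall>\<phi>\<in>test_functions_01.
     (LINT x|\<mu>. f x * (deriv ^^ j) \<phi> x) = (- 1) ^ j * (LINT x|\<mu>. g x * \<phi> x))"
  by (simp add: has_weak_deriv_01_def set_integral_unit_interval)

lemma has_weak_deriv_01_unique:
  assumes "g \<in> L2_01" "h \<in> L2_01" "has_weak_deriv_01 j f g" "has_weak_deriv_01 j f h"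
  shows "AE x in \<mu>. g x = h x"
proof -
  have "AE x in \<mu>. g x - h x = 0"
  proof (rule AE_zero_if_orthogonal_to_bumps)
    show "integrable \<mu> (\<lambda>x. g x - h x)"
      using assms by (intro L2_01_integrable) auto
    fix \<epsilon> a b :: real assume "\<epsilon> > 0" "0 < a" "a < b" "b < 1"
    then have t: "bump \<epsilon> a b \<in> test_functions_01" by (intro bump_test_function) auto
    then have "(LINT x|\<mu>. g x * bump \<epsilon> a b x) = (LINT x|\<mu>. h x * bump \<epsilon> a b x)"
      using assms(3,4) by (simp add: has_weak_deriv_01_iff)
    then show "(LINT x|\<mu>. (g x - h x) * bump \<epsilon> a b x) = 0"
      using L2_01_integrable_mult[OF _ test_function_L2[OF t]] assms(1,2)
      by (simp add: left_diff_distrib)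
  qed
  then show ?thesis by simp
qed

text \<open>The choice inside \<open>weak_deriv_01\<close> is harmless: square integrable weak
  derivatives agree almost everywhere, so any of them computes the norm.\<close>

lemma L2_norm_weak_deriv_01:
  assumes g: "g \<in> L2_01" "has_weak_deriv_01 j f g"
  shows "(L2_norm_01 (weak_deriv_01 j f))\<^sup>2 = (LINT x|\<mu>. (g x)\<^sup>2)"
proof -
  define h where "h = weak_deriv_01 j f"
  have h: "h \<in> L2_01 \<and> has_weak_deriv_01 j f h"
    unfolding h_def weak_deriv_01_def by (rule someI[of _ g]) (use g in simp)
  have "AE x in \<mu>. h x = g x"
    using has_weak_deriv_01_unique h g by blast
  then have "(LINT x|\<mu>. (h x)\<^sup>2) = (LINT x|\<mu>. (g x)\<^sup>2)"
    by (intro integral_cong_AE)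
       (use h g in \<open>auto simp: L2_01_iff elim!: eventually_mono\<close>)
  then show ?thesis
    by (simp add: L2_norm_01_def set_integral_unit_interval flip: h_def)
qed

lemma integral_primitive_deriv_test_function:
  assumes g: "g \<in> L2_01" and \<phi>: "\<phi> \<in> test_functions_01"
  shows "(LINT x|\<mu>. primitive_01 g x * deriv \<phi> x) = - (LINT x|\<mu>. g x * \<phi> x)"
proof -
  have d: "integrable \<mu> (deriv \<phi>)"
    using deriv_test_function[OF \<phi>] by (intro L2_01_integrable test_function_L2)
  have "(LINT x|\<mu>. deriv \<phi> x) = 0"
    using primitive_deriv_test_function[OF \<phi>, of 1] test_functions_01_outside[OF \<phi>, of 1] by simp
  then have "(LINT x|\<mu>. deriv \<phi> x * primitive_01 g x) + (LINT x|\<mu>. primitive_01 (deriv \<phi>) x * g x) = 0"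
    using integral_by_parts_01[OF d L2_01_integrable[OF g]] by simp
  moreover have "(LINT x|\<mu>. primitive_01 (deriv \<phi>) x * g x) = (LINT x|\<mu>. g x * \<phi> x)"
    by (rule Bochner_Integration.integral_cong) (auto simp: primitive_deriv_test_function[OF \<phi>])
  ultimately show ?thesis by (simp add: mult.commute)
qed

text \<open>One integration by parts against a derivative of the test function; the constant
  \<open>c\<close> drops out because derivatives of test functions have mean zero.\<close>

lemma has_weak_deriv_01_primitive:
  assumes f: "f \<in> L2_01" and w: "has_weak_deriv_01 j f h"
    and F: "\<And>x. 0 < x \<Longrightarrow> x < 1 \<Longrightarrow> F x = c + primitive_01 f x"
  shows "has_weak_deriv_01 (Suc j) F h"
  unfolding has_weak_deriv_01_iff
proof
  fix \<phi> assume \<phi>: "\<phi> \<in> test_functions_01"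
  define \<psi> where "\<psi> = (deriv ^^ j) \<phi>"
  have \<psi>: "\<psi> \<in> test_functions_01"
    unfolding \<psi>_def using \<phi> by (rule higher_deriv_test_function)
  have d: "deriv \<psi> \<in> L2_01"
    using deriv_test_function[OF \<psi>] by (intro test_function_L2)
  have "(LINT x|\<mu>. deriv \<psi> x) = 0"
    using primitive_deriv_test_function[OF \<psi>, of 1] test_functions_01_outside[OF \<psi>, of 1] by simp
  then have "(LINT x|\<mu>. c * deriv \<psi> x + primitive_01 f x * deriv \<psi> x) = - (LINT x|\<mu>. f x * \<psi> x)"
    using d integral_primitive_deriv_test_function[OF f \<psi>]
      L2_01_integrable_mult[OF primitive_01_L2[OF L2_01_integrable[OF f]] d]
    by (simp add: L2_01_integrable)
  moreover have "(LINT x|\<mu>. F x * deriv \<psi> x) = (LINT x|\<mu>. c * deriv \<psi> x + primitive_01 f x * deriv \<psi> x)"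
    by (rule Bochner_Integration.integral_cong) (auto simp: F algebra_simps)
  ultimately show "(LINT x|\<mu>. F x * (deriv ^^ Suc j) \<phi> x) = (- 1) ^ Suc j * (LINT x|\<mu>. h x * \<phi> x)"
    using w \<phi> by (simp add: has_weak_deriv_01_iff \<psi>_def)
qed

text \<open>The difference of \<open>f\<close> and the primitive of \<open>g\<close> is orthogonal
  to all derivatives of test functions, so du Bois-Reymond applies.\<close>

lemma has_weak_deriv_01_imp_primitive:
  assumes "f \<in> L2_01" "g \<in> L2_01" "has_weak_deriv_01 1 f g"
  shows "\<exists>c. AE x in \<mu>. f x = c + primitive_01 g x"
proof -
  have P: "primitive_01 g \<in> L2_01" using assms by (intro primitive_01_L2 L2_01_integrable)
  have "\<exists>c. AE x in \<mu>. f x - primitive_01 g x = c"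
  proof (rule du_Bois_Reymond_01)
    show "(\<lambda>x. f x - primitive_01 g x) \<in> L2_01" using P assms by auto
    fix \<phi> assume \<phi>: "\<phi> \<in> test_functions_01"
    then have d: "deriv \<phi> \<in> L2_01" by (intro test_function_L2 deriv_test_function)
    have "(LINT x|\<mu>. f x * deriv \<phi> x) = - (LINT x|\<mu>. g x * \<phi> x)"
      using assms(3) \<phi> by (simp add: has_weak_deriv_01_iff)
    then show "(LINT x|\<mu>. (f x - primitive_01 g x) * deriv \<phi> x) = 0"
      using integral_primitive_deriv_test_function[OF assms(2) \<phi>]
        L2_01_integrable_mult[OF assms(1) d] L2_01_integrable_mult[OF P d]
      by (simp add: left_diff_distrib)
  qed
  then obtain c where "AE x in \<mu>. f x - primitive_01 g x = c" ..
  then show ?thesis by (intro exI[of _ c]) (auto elim!: eventually_mono)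
qed

text \<open>Testing the first identity against \<open>(deriv ^^ j) \<phi>\<close> peels off one
  derivative, as the induction over the order requires.\<close>

lemma has_weak_deriv_01_shift:
  assumes "has_weak_deriv_01 1 f g" "has_weak_deriv_01 (Suc j) f h"
  shows "has_weak_deriv_01 j g h"
  unfolding has_weak_deriv_01_iff
proof
  fix \<phi> assume \<phi>: "\<phi> \<in> test_functions_01"
  have "(LINT x|\<mu>. f x * deriv ((deriv ^^ j) \<phi>) x) = - (LINT x|\<mu>. g x * (deriv ^^ j) \<phi> x)"
    using assms(1) higher_deriv_test_function[OF \<phi>, of j] by (simp add: has_weak_deriv_01_iff)
  moreover have "(LINT x|\<mu>. f x * deriv ((deriv ^^ j) \<phi>) x) = - ((- 1) ^ j * (LINT x|\<mu>. h x * \<phi> x))"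
    using assms(2) \<phi> by (simp add: has_weak_deriv_01_iff)
  ultimately show "(LINT x|\<mu>. g x * (deriv ^^ j) \<phi> x) = (- 1) ^ j * (LINT x|\<mu>. h x * \<phi> x)"
    by simp
qed

section \<open>Sobolev functions as iterated primitives\<close>

text \<open>A condition on coefficients instead of \<open>degree p < k\<close> keeps the zero
  polynomial at \<open>k = 0\<close>, the base of the inductions over \<open>k\<close>.\<close>

definition poly_lt :: "nat \<Rightarrow> real poly set" where
  "poly_lt k = {p. \<forall>i\<ge>k. coeff p i = 0}"

lemma poly_lt_add_smult: "p \<in> poly_lt k \<Longrightarrow> q \<in> poly_lt k \<Longrightarrow> p + smult c q \<in> poly_lt k"
  by (simp add: poly_lt_def)

lemma zero_poly_lt [simp]: "0 \<in> poly_lt k"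
  by (simp add: poly_lt_def)

lemma pderiv_poly_lt: "p \<in> poly_lt (Suc k) \<Longrightarrow> pderiv p \<in> poly_lt k"
  by (simp add: poly_lt_def coeff_pderiv)

lemma sum_monom_poly_lt: "(\<Sum>j<k. smult (c j) (monom 1 j)) \<in> poly_lt k"
  by (auto simp: poly_lt_def coeff_sum)

lemma poly_lt_eq_sum_monom:
  assumes "p \<in> poly_lt k" shows "p = (\<Sum>j<k. smult (coeff p j) (monom 1 j))"
  by (rule poly_eqI)
     (use assms in \<open>auto simp: poly_lt_def coeff_sum if_distrib[of "(*) _"] cong: if_cong\<close>)

lemma degree_poly_lt: "p \<in> poly_lt (Suc k) \<Longrightarrow> degree p \<le> k"
  by (auto simp: poly_lt_def intro!: degree_le)

lemma poly_lt_antideriv: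
  assumes "p \<in> poly_lt k"
  obtains P where "P \<in> poly_lt (Suc k)" "pderiv P = p" "poly P 0 = c"
proof
  define Q where "Q = (\<Sum>j<k. monom (coeff p j / real (Suc j)) (Suc j))"
  have Q: "coeff Q i = (if i = 0 \<or> i > k then 0 else coeff p (i - 1) / real i)" for i
    unfolding Q_def coeff_sum by (cases i) auto
  show "[:c:] + Q \<in> poly_lt (Suc k)"
    by (auto simp: poly_lt_def Q coeff_pCons split: nat.splits)
  show "pderiv ([:c:] + Q) = p"
    by (rule poly_eqI) (use assms in \<open>auto simp: poly_lt_def coeff_pderiv coeff_pCons Q\<close>)
  show "poly ([:c:] + Q) 0 = c"
    by (simp add: poly_0_coeff_0 Q)
qed

lemma L2_01_poly [simp]: "poly p \<in> L2_01"
  by (intro L2_01_continuous continuous_on_poly continuous_on_id)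

lemma primitive_01_poly:
  assumes "0 \<le> x" "x \<le> 1"
  shows "primitive_01 (poly (pderiv p)) x = poly p x - poly p 0"
  by (rule primitive_01_FTC) (use assms in \<open>auto intro!: poly_DERIV continuous_on_poly continuous_on_id\<close>)

section \<open>Taylor representation by iterated primitives\<close>

lemma primitive_01_funpow_L2: "g \<in> L2_01 \<Longrightarrow> (primitive_01 ^^ k) g \<in> L2_01"
  by (induction k) (auto intro: primitive_01_L2 L2_01_integrable)

lemma primitive_01_funpow_linear:
  assumes "f \<in> L2_01" "g \<in> L2_01"
  shows "(primitive_01 ^^ k) (\<lambda>x. f x + c * g x) = (\<lambda>x. (primitive_01 ^^ k) f x + c * (primitive_01 ^^ k) g x)"
proof (induction k)
  case (Suc k)
  have "integrable \<mu> ((primitive_01 ^^ k) f)" "integrable \<mu> ((primitive_01 ^^ k) g)"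
    using assms by (auto intro!: L2_01_integrable primitive_01_funpow_L2)
  then show ?case by (auto simp: Suc primitive_01_add primitive_01_cmult)
qed simp

lemma primitive_01_funpow_zero:
  assumes "g \<in> L2_01" "AE x in \<mu>. g x = 0" "k > 0"
  shows "(primitive_01 ^^ k) g = (\<lambda>x. 0)"
proof -
  have z: "primitive_01 (\<lambda>x. 0) = (\<lambda>x. 0)" by (auto simp: primitive_01_def)
  have 0: "primitive_01 g = (\<lambda>x. 0)"
    using primitive_01_cong_AE[OF assms(2)] assms(1) z by (auto simp: L2_01_measurable)
  obtain m where "k = Suc m" using assms(3) by (cases k) auto
  moreover have "(primitive_01 ^^ Suc m) g = (\<lambda>x. 0)"
    by (induction m) (auto simp: 0 z)
  ultimately show ?thesis by simp
qed

text \<open>For \<open>p\<close> in \<open>poly_lt k\<close> this is Taylor's formula at 0 with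
  integral remainder: \<open>p\<close> is the Taylor polynomial and \<open>g\<close> the derivative
  of order \<open>k\<close>.\<close>

definition poly_primitive :: "nat \<Rightarrow> real poly \<Rightarrow> (real \<Rightarrow> real) \<Rightarrow> real \<Rightarrow> real" where
  "poly_primitive k p g x = poly p x + (primitive_01 ^^ k) g x"

lemma poly_primitive_L2: "g \<in> L2_01 \<Longrightarrow> poly_primitive k p g \<in> L2_01"
  unfolding poly_primitive_def by (intro L2_01_add L2_01_poly primitive_01_funpow_L2)

lemma poly_primitive_continuous:
  assumes "k > 0" "g \<in> L2_01"
  shows "continuous_on A (poly_primitive k p g)"
proof -
  obtain m where "k = Suc m" using assms(1) by (cases k) auto
  then show ?thesis unfolding poly_primitive_def
    using assms(2)
    by (auto intro!: continuous_intros primitive_01_continuous L2_01_integrable primitive_01_funpow_L2)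
qed

text \<open>Differentiating once lowers \<open>k\<close> and replaces \<open>p\<close> by
  \<open>pderiv p\<close>. Both directions of the Sobolev characterization run on this
  recursion.\<close>

lemma poly_primitive_Suc:
  assumes "g \<in> L2_01" "0 \<le> x" "x \<le> 1"
  shows "poly_primitive (Suc k) p g x = poly p 0 + primitive_01 (poly_primitive k (pderiv p) g) x"
proof -
  have "primitive_01 (poly_primitive k (pderiv p) g) x
      = primitive_01 (poly (pderiv p)) x + primitive_01 ((primitive_01 ^^ k) g) x"
    unfolding poly_primitive_def using assms(1)
    by (intro primitive_01_add L2_01_integrable primitive_01_funpow_L2) auto
  then show ?thesis using primitive_01_poly[OF assms(2,3), of p]
    by (simp add: poly_primitive_def)
qed

lemma has_weak_deriv_01_0: "has_weak_deriv_01 0 f f"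
  by (simp add: has_weak_deriv_01_iff)

lemma poly_primitive_weak_derivs:
  assumes "g \<in> L2_01"
  shows "p \<in> poly_lt k \<Longrightarrow> has_weak_deriv_01 k (poly_primitive k p g) g"
    and "j \<le> k \<Longrightarrow> \<exists>h\<in>L2_01. has_weak_deriv_01 j (poly_primitive k p g) h"
proof -
  show "p \<in> poly_lt k \<Longrightarrow> has_weak_deriv_01 k (poly_primitive k p g) g"
  proof (induction k arbitrary: p)
    case 0
    then have "p = 0" by (auto simp: poly_lt_def intro: poly_eqI)
    then show ?case using has_weak_deriv_01_0[of g] by (simp add: poly_primitive_def)
  next
    case (Suc k)
    show ?case
      by (rule has_weak_deriv_01_primitive[OF poly_primitive_L2 Suc.IH[OF pderiv_poly_lt]])
         (use Suc.prems assms poly_primitive_Suc in auto)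
  qed
  show "j \<le> k \<Longrightarrow> \<exists>h\<in>L2_01. has_weak_deriv_01 j (poly_primitive k p g) h"
  proof (induction k arbitrary: p j)
    case 0
    then show ?case using has_weak_deriv_01_0 poly_primitive_L2[OF assms] by auto
  next
    case (Suc k)
    show ?case
    proof (cases j)
      case 0
      then show ?thesis using has_weak_deriv_01_0 poly_primitive_L2[OF assms] by blast
    next
      case (Suc i)
      then obtain h where h: "h \<in> L2_01" "has_weak_deriv_01 i (poly_primitive k (pderiv p) g) h"
        using Suc.IH[of i "pderiv p"] Suc.prems by auto
      have "has_weak_deriv_01 (Suc i) (poly_primitive (Suc k) p g) h"
        by (rule has_weak_deriv_01_primitive[OF poly_primitive_L2 h(2)])
           (use assms poly_primitive_Suc in auto)
      then show ?thesis using h(1) Suc by blast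
    qed
  qed
qed

text \<open>The induction hypothesis is applied to the first weak derivative, and the result is
  integrated; the integration constant becomes the value of the new polynomial at 0.\<close>

lemma weak_derivs_imp_poly_primitive:
  assumes "f \<in> L2_01" "\<forall>j\<le>k. \<exists>g\<in>L2_01. has_weak_deriv_01 j f g"
  shows "\<exists>p\<in>poly_lt k. \<exists>g\<in>L2_01. AE x in \<mu>. f x = poly_primitive k p g x"
  using assms
proof (induction k arbitrary: f)
  case 0
  then show ?case
    by (intro bexI[of _ 0] bexI[of _ f]) (simp_all add: poly_primitive_def)
next
  case (Suc k)
  obtain f' where f': "f' \<in> L2_01" "has_weak_deriv_01 1 f f'"
    using Suc.prems(2)[rule_format, of 1] by auto
  have "\<forall>j\<le>k. \<exists>g\<in>L2_01. has_weak_deriv_01 j f' g"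
    using Suc.prems(2) has_weak_deriv_01_shift[OF f'(2)] by (meson Suc_le_mono)
  then obtain q g where q: "q \<in> poly_lt k" and g: "g \<in> L2_01"
    and eq: "AE x in \<mu>. f' x = poly_primitive k q g x"
    using Suc.IH[OF f'(1)] by blast
  obtain c where c: "AE x in \<mu>. f x = c + primitive_01 f' x"
    using has_weak_deriv_01_imp_primitive[OF Suc.prems(1) f'] by blast
  obtain p where p: "p \<in> poly_lt (Suc k)" "pderiv p = q" "poly p 0 = c"
    using poly_lt_antideriv[OF q] by blast
  have prim: "primitive_01 f' x = primitive_01 (poly_primitive k q g) x" for x
    using eq f'(1) poly_primitive_L2[OF g] by (intro primitive_01_cong_AE L2_01_measurable)
  have "AE x in \<mu>. f x = poly_primitive (Suc k) p g x"
    using c AE_space[of \<mu>] by eventually_elim (use poly_primitive_Suc[OF g] p prim in auto)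
  then show ?case using p(1) g by blast
qed

text \<open>The continuous non-negative function \<open>(h x)\<^sup>2\<close> has integral zero.
  This removes the exceptional null set from the representation, endpoints included.\<close>

lemma continuous_AE_zero:
  assumes c: "continuous_on {0..1} h" and ae: "AE x in \<mu>. h x = (0::real)" and x: "x \<in> {0..1}"
  shows "h x = 0"
proof -
  have c2: "continuous_on {0..1} (\<lambda>x. (h x)\<^sup>2)" using c by (intro continuous_intros)
  have "(LINT t|\<mu>. (h t)\<^sup>2) = 0"
    using ae by (intro integral_eq_zero_AE) (auto elim!: eventually_mono)
  then have "integral {0..1} (\<lambda>x. (h x)\<^sup>2) = 0"
    using primitive_01_eq_integral[OF c2, of 1] by simp
  then show ?thesis using integral_eq_0_iff[OF c2] x by auto
qed

lemma sobolev_01_iff: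
  assumes "k > 0"
  shows "f \<in> sobolev_01 k \<longleftrightarrow> f \<in> extensional {0..1} \<and>
    (\<exists>p\<in>poly_lt k. \<exists>g\<in>L2_01. \<forall>x\<in>{0..1}. f x = poly_primitive k p g x)"
proof safe
  assume f: "f \<in> sobolev_01 k"
  then show "f \<in> extensional {0..1}" by (simp add: sobolev_01_def)
  obtain p g where p: "p \<in> poly_lt k" and g: "g \<in> L2_01"
    and eq: "AE x in \<mu>. f x = poly_primitive k p g x"
    using weak_derivs_imp_poly_primitive[of f k] f by (auto simp: sobolev_01_def)
  have "f x - poly_primitive k p g x = 0" if "x \<in> {0..1}" for x
    by (rule continuous_AE_zero[OF _ _ that])
       (use f eq poly_primitive_continuous[OF assms g] in
         \<open>auto simp: sobolev_01_def intro!: continuous_on_diff\<close>)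
  then show "\<exists>p\<in>poly_lt k. \<exists>g\<in>L2_01. \<forall>x\<in>{0..1}. f x = poly_primitive k p g x"
    using p g by force
next
  fix p g assume ext: "f \<in> extensional {0..1}" and p: "p \<in> poly_lt k" and g: "g \<in> L2_01"
    and eq: "\<forall>x\<in>{0..1}. f x = poly_primitive k p g x"
  have c: "continuous_on {0..1} f"
    using poly_primitive_continuous[OF assms g] eq by (subst continuous_on_cong[OF refl]) auto
  have "\<exists>h\<in>L2_01. has_weak_deriv_01 j f h" if j: "j \<le> k" for j
  proof -
    have "(LINT x|\<mu>. f x * (deriv ^^ j) \<phi> x)
        = (LINT x|\<mu>. poly_primitive k p g x * (deriv ^^ j) \<phi> x)" for \<phi>
      by (rule Bochner_Integration.integral_cong) (use eq in auto)
    then show ?thesis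
      using poly_primitive_weak_derivs(2)[OF g j, of p] by (simp add: has_weak_deriv_01_iff)
  qed
  then show "f \<in> sobolev_01 k"
    using ext c L2_01_continuous[OF c] by (auto simp: sobolev_01_def)
qed

lemma L2_norm_weak_deriv_poly_primitive:
  assumes "p \<in> poly_lt k" "g \<in> L2_01" "\<forall>x\<in>{0..1}. f x = poly_primitive k p g x"
  shows "(L2_norm_01 (weak_deriv_01 k f))\<^sup>2 = (LINT x|\<mu>. (g x)\<^sup>2)"
proof (rule L2_norm_weak_deriv_01[OF assms(2)])
  have "(LINT x|\<mu>. f x * (deriv ^^ k) \<phi> x)
      = (LINT x|\<mu>. poly_primitive k p g x * (deriv ^^ k) \<phi> x)" for \<phi>
    by (rule Bochner_Integration.integral_cong) (use assms(3) in auto)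
  then show "has_weak_deriv_01 k f g"
    using poly_primitive_weak_derivs(1)[OF assms(2,1)] by (simp add: has_weak_deriv_01_iff)
qed

section \<open>Cell averages as functionals\<close>

text \<open>By parts, the adjoint of integration from 0 is integration up to 1: it sends
  \<open>a\<close> to \<open>a'\<close>, the integral of \<open>a\<close> from \<open>t\<close> to
  1. Applying it \<open>k\<close> times produces \<open>K\<close>.\<close>

lemma primitive_01_funpow_adjoint:
  assumes "a \<in> L2_01"
  shows "\<exists>K\<in>L2_01. \<forall>g\<in>L2_01. (LINT x|\<mu>. a x * (primitive_01 ^^ k) g x) = (LINT x|\<mu>. K x * g x)"
  using assms
proof (induction k arbitrary: a)
  case 0
  then show ?case by (intro bexI[of _ a]) auto
next
  case (Suc k)
  define a' where "a' = (\<lambda>t. (LINT x|\<mu>. a x) - primitive_01 a t)"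
  have Pa: "primitive_01 a \<in> L2_01" using Suc.prems by (intro primitive_01_L2 L2_01_integrable)
  then have "a' \<in> L2_01" unfolding a'_def by auto
  then obtain K where K: "K \<in> L2_01"
    "\<forall>g\<in>L2_01. (LINT x|\<mu>. a' x * (primitive_01 ^^ k) g x) = (LINT x|\<mu>. K x * g x)"
    using Suc.IH by blast
  have "(LINT x|\<mu>. a x * (primitive_01 ^^ Suc k) g x) = (LINT x|\<mu>. K x * g x)" if g: "g \<in> L2_01" for g
  proof -
    have h: "(primitive_01 ^^ k) g \<in> L2_01" using g by (rule primitive_01_funpow_L2)
    have "(LINT x|\<mu>. a x * (primitive_01 ^^ Suc k) g x) = (LINT x|\<mu>. a' x * (primitive_01 ^^ k) g x)"
      using integral_by_parts_01[OF L2_01_integrable[OF Suc.prems] L2_01_integrable[OF h]]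
        L2_01_integrable_mult[OF Pa h] L2_01_integrable[OF h]
      by (simp add: a'_def left_diff_distrib)
    then show ?thesis using K(2) g by simp
  qed
  then show ?case using K(1) by blast
qed

definition cell_weight :: "nat \<Rightarrow> nat \<Rightarrow> real \<Rightarrow> real" where
  "cell_weight M i x = real M * indicator {real (i - 1) / real M..real i / real M} x"

lemma cell_weight_L2: "cell_weight M i \<in> L2_01"
proof (rule L2_01_bounded[of _ "real M"])
  show "cell_weight M i \<in> borel_measurable \<mu>"
    by (rule measurable_mu, unfold cell_weight_def) measurable
qed (auto simp: cell_weight_def indicator_def)

lemma cell_subset:
  assumes "1 \<le> i" "i \<le> M"
  shows "{real (i - 1) / real M..real i / real M} \<subseteq> {0..1}"
    and "real (i - 1) / real M \<le> real i / real M"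
proof -
  have "real i / real M \<le> 1" using assms by simp
  then show "{real (i - 1) / real M..real i / real M} \<subseteq> {0..1}"
    by (auto intro: order_trans[of 0])
  show "real (i - 1) / real M \<le> real i / real M" by (intro divide_right_mono) auto
qed

lemma cell_average_eq:
  assumes "1 \<le> i" "i \<le> M" "\<forall>x\<in>{0..1}. f x = F x" "continuous_on UNIV F"
  shows "cell_average M f i = (LINT x|\<mu>. cell_weight M i x * F x)"
proof -
  let ?C = "{real (i - 1) / real M..real i / real M}"
  have F: "F \<in> borel_measurable lebesgue"
    using borel_measurable_continuous_onI[OF assms(4)] by (intro measurable_completion) simp
  have "cell_average M f i = (LINT x|lebesgue. real M * (indicator ?C x * f x))"
    by (simp add: cell_average_def set_lebesgue_integral_def)
  also have "\<dots> = (LINT x|lebesgue. real M * (indicator ?C x * F x))"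
  proof (rule Bochner_Integration.integral_cong)
    show "real M * (indicator ?C x * f x) = real M * (indicator ?C x * F x)" for x
    proof (cases "x \<in> ?C")
      case True
      then have "f x = F x" using cell_subset(1)[OF assms(1,2)] assms(3) by blast
      then show ?thesis by simp
    qed simp
  qed simp
  also have "\<dots> = (LINT x|lebesgue. indicator {0<..<1} x * (cell_weight M i x * F x))"
  proof (rule integral_cong_AE)
    \<comment> \<open>The outermost cells contain 0 or 1, which \<open>\<mu>\<close> leaves out;
      these are two null points.\<close>
    have "AE x in lebesgue. x \<noteq> 0 \<and> x \<noteq> (1::real)"
      by (intro AE_conjI AE_completion AE_lborel_singleton)
    then show "AE x in lebesgue. real M * (indicator ?C x * F x)
        = indicator {0<..<1} x * (cell_weight M i x * F x)"
    proof eventually_elim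
      case (elim x)
      have "x \<in> {0<..<1}" if "x \<in> ?C"
        using subsetD[OF cell_subset(1)[OF assms(1,2)] that] elim by auto
      then show ?case
        by (auto simp: indicator_def cell_weight_def)
    qed
  qed (auto simp: cell_weight_def intro!: borel_measurable_times borel_measurable_indicator F)
  finally show ?thesis
    by (simp add: unit_lebesgue_def integral_restrict_space)
qed

text \<open>Point evaluations at the two endpoints are numbered 0 and \<open>M + 1\<close>.\<close>

definition observation :: "nat \<Rightarrow> nat \<Rightarrow> (real \<Rightarrow> real) \<Rightarrow> real" where
  "observation M i f = (if i = 0 then f 0 else if i \<le> M then cell_average M f i else f 1)"

lemma observation_cong:
  assumes "\<forall>x\<in>{0..1}. f x = F x" "continuous_on UNIV F"
  shows "observation M i f = observation M i F"
proof -
  have "cell_average M f i = cell_average M F i" if "1 \<le> i" "i \<le> M"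
    using cell_average_eq[OF that assms] cell_average_eq[OF that _ assms(2), of F] by simp
  then show ?thesis using assms(1) by (auto simp: observation_def)
qed

lemma observation_poly_linear:
  "observation M i (poly (p + smult c q)) = observation M i (poly p) + c * observation M i (poly q)"
proof -
  have "cell_average M (poly (p + smult c q)) i = cell_average M (poly p) i + c * cell_average M (poly q) i"
    if i: "1 \<le> i" "i \<le> M"
  proof -
    have eq: "cell_average M (poly r) i = (LINT x|\<mu>. cell_weight M i x * poly r x)" for r
      by (rule cell_average_eq[OF i]) (auto intro!: continuous_intros)
    have int: "integrable \<mu> (\<lambda>x. cell_weight M i x * poly r x)" for r
      by (intro L2_01_integrable_mult cell_weight_L2 L2_01_poly)
    have "(LINT x|\<mu>. cell_weight M i x * poly (p + smult c q) x)
       = (LINT x|\<mu>. cell_weight M i x * poly p x + c * (cell_weight M i x * poly q x))"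
      by (simp add: algebra_simps)
    then show ?thesis unfolding eq using int by simp
  qed
  then show ?thesis by (simp add: observation_def)
qed

text \<open>For a cell, \<open>K\<close> is the \<open>k\<close>-fold adjoint of its weight. At 0
  the iterated primitive vanishes, so \<open>K\<close> is zero. At 1 its value is the integral of
  the primitive of order \<open>m = k - 1\<close>, so the adjoint of the constant 1 is taken
  \<open>m\<close> times.\<close>

lemma observation_poly_primitive:
  assumes "k > 0"
  shows "\<exists>K\<in>L2_01. \<forall>p. \<forall>g\<in>L2_01. observation M i (poly_primitive k p g)
     = observation M i (poly p) + (LINT x|\<mu>. K x * g x)"
proof -
  obtain m where k: "k = Suc m" using assms by (cases k) auto
  consider "i = 0" | "1 \<le> i" "i \<le> M" | "i > M" by linarith
  then show ?thesis
  proof cases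
    case 1
    then show ?thesis
      by (intro bexI[of _ "\<lambda>x. 0"]) (auto simp: observation_def poly_primitive_def k)
  next
    case 2
    obtain K where K: "K \<in> L2_01"
      "\<forall>g\<in>L2_01. (LINT x|\<mu>. cell_weight M i x * (primitive_01 ^^ k) g x) = (LINT x|\<mu>. K x * g x)"
      using primitive_01_funpow_adjoint[OF cell_weight_L2] by blast
    have "observation M i (poly_primitive k p g) = observation M i (poly p) + (LINT x|\<mu>. K x * g x)"
      if g: "g \<in> L2_01" for p g
    proof -
      have "cell_average M (poly_primitive k p g) i = (LINT x|\<mu>. cell_weight M i x * poly_primitive k p g x)"
        by (rule cell_average_eq[OF 2]) (use poly_primitive_continuous[OF assms g] in auto)
      also have "\<dots> = (LINT x|\<mu>. cell_weight M i x * poly p x + cell_weight M i x * (primitive_01 ^^ k) g x)"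
        by (simp add: poly_primitive_def algebra_simps)
      also have "\<dots> = (LINT x|\<mu>. cell_weight M i x * poly p x)
          + (LINT x|\<mu>. cell_weight M i x * (primitive_01 ^^ k) g x)"
        by (intro Bochner_Integration.integral_add L2_01_integrable_mult cell_weight_L2 L2_01_poly
            primitive_01_funpow_L2 g)
      also have "(LINT x|\<mu>. cell_weight M i x * poly p x) = cell_average M (poly p) i"
        by (rule cell_average_eq[OF 2, symmetric]) (auto intro!: continuous_intros)
      finally show ?thesis using 2 K(2) g by (simp add: observation_def)
    qed
    then show ?thesis using K(1) by blast
  next
    case 3
    obtain K where K: "K \<in> L2_01"
      "\<forall>g\<in>L2_01. (LINT x|\<mu>. 1 * (primitive_01 ^^ m) g x) = (LINT x|\<mu>. K x * g x)"
      using primitive_01_funpow_adjoint[OF L2_01_const] by blast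
    then show ?thesis using 3
      by (intro bexI[of _ K]) (auto simp: observation_def poly_primitive_def k)
  qed
qed

text \<open>The antiderivative \<open>P\<close> with \<open>P(0) = 0\<close> takes equal values at
  neighbouring grid points. It thus has \<open>M + 1\<close> roots, but its degree is at most
  \<open>k\<close>, which is at most \<open>M\<close>.\<close>

lemma poly_zero_if_cell_averages_zero:
  assumes p: "p \<in> poly_lt k" and M: "k \<le> M" "0 < M"
    and zero: "\<And>i. 1 \<le> i \<Longrightarrow> i \<le> M \<Longrightarrow> cell_average M (poly p) i = 0"
  shows "p = 0"
proof -
  obtain P where P: "P \<in> poly_lt (Suc k)" "pderiv P = p" "poly P 0 = 0"
    using poly_lt_antideriv[OF p] by blast
  have step: "poly P (real i / real M) = poly P (real (i - 1) / real M)" if i: "1 \<le> i" "i \<le> M" for i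
  proof -
    let ?a = "real (i - 1) / real M" and ?b = "real i / real M"
    have "set_integrable lebesgue {?a..?b} (poly p)"
      by (intro absolutely_integrable_continuous_real continuous_on_poly continuous_on_id)
    then have "(LINT x:{?a..?b}|lebesgue. poly p x) = integral {?a..?b} (poly p)"
      by (rule set_lebesgue_integral_eq_integral)
    moreover have "(poly p has_integral poly P ?b - poly P ?a) {?a..?b}"
      by (rule fundamental_theorem_of_calculus[OF cell_subset(2)[OF i]])
         (use poly_DERIV[of P] P(2) in \<open>auto simp flip: has_real_derivative_iff_has_vector_derivative
            intro: has_field_derivative_at_within\<close>)
    ultimately show ?thesis
      using zero[OF i] M(2) by (simp add: cell_average_def integral_unique)
  qed
  have roots: "poly P (real i / real M) = 0" if "i \<le> M" for i
    using that
  proof (induction i)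
    case (Suc i)
    then show ?case using step[of "Suc i"] by simp
  qed (simp add: P(3))
  have "P = 0"
  proof (rule ccontr)
    assume "P \<noteq> 0"
    have "card ((\<lambda>i. real i / real M) ` {..M}) \<le> card {x. poly P x = 0}"
      using roots \<open>P \<noteq> 0\<close> by (intro card_mono poly_roots_finite) auto
    also have "\<dots> \<le> degree P" using \<open>P \<noteq> 0\<close> by (rule card_poly_roots_bound)
    also have "\<dots> \<le> k" using P(1) by (rule degree_poly_lt)
    finally show False
      using M by (subst (asm) card_image) (auto simp: inj_on_def)
  qed
  then show ?thesis using P(2) by simp
qed

section \<open>The finite Euler-Lagrange system\<close>

lemma L2_01_square_integral_zero:
  assumes "g \<in> L2_01" "(LINT x|\<mu>. (g x)\<^sup>2) = 0"
  shows "AE x in \<mu>. g x = 0"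
proof -
  have "AE x in \<mu>. (g x)\<^sup>2 = 0"
    using integral_nonneg_eq_0_iff_AE[OF L2_01_square[OF assms(1)]] assms(2) by simp
  then show ?thesis by simp
qed

lemma L2_01_integral_sum_left:
  assumes "\<And>i. i \<in> A \<Longrightarrow> K i \<in> L2_01" "g \<in> L2_01"
  shows "(LINT x|\<mu>. (\<Sum>i\<in>A. e i * K i x) * g x) = (\<Sum>i\<in>A. e i * (LINT x|\<mu>. K i x * g x))"
proof -
  have "(LINT x|\<mu>. (\<Sum>i\<in>A. e i * K i x) * g x) = (LINT x|\<mu>. (\<Sum>i\<in>A. e i * (K i x * g x)))"
    by (simp add: sum_distrib_right mult.assoc)
  also have "\<dots> = (\<Sum>i\<in>A. LINT x|\<mu>. e i * (K i x * g x))"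
    using L2_01_integrable_mult assms by (intro Bochner_Integration.integral_sum) auto
  finally show ?thesis by simp
qed

lemma linear_poly_lt_sum:
  fixes P :: "real poly \<Rightarrow> real" and m :: nat
  assumes lin: "\<And>p q c. P (p + smult c q) = P p + c * P q"
  shows "P (\<Sum>j<m. smult (c j) (r j)) = (\<Sum>j<m. c j * P (r j))"
proof (induction m)
  case 0
  show ?case using lin[of 0 1 0] lin[of 0 "-1" 0] lin[of 0 1 0] lin[of 0 0 1] by simp
qed (simp add: lin)

text \<open>The weights \<open>w i\<close> are Lagrange multipliers: \<open>\<theta> i = 0\<close> makes the \<open>i\<close>-th equation
  a hard constraint, and the last conclusion is stationarity with respect to the polynomial part.\<close>

lemma saddle_point_system_solvable:
  fixes K :: "nat \<Rightarrow> real \<Rightarrow> real" and P :: "nat \<Rightarrow> real poly \<Rightarrow> real" and \<theta> b :: "nat \<Rightarrow> real"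
  assumes \<alpha>: "\<alpha> > 0" and K: "\<And>i. K i \<in> L2_01"
    and lin: "\<And>i p q c. P i (p + smult c q) = P i p + c * P i q"
    and \<theta>: "\<And>i. \<theta> i \<ge> 0"
    and ker: "\<And>e. \<lbrakk>\<And>p. p \<in> poly_lt k \<Longrightarrow> (\<Sum>i<n. e i * P i p) = 0; \<And>i. i < n \<Longrightarrow> \<theta> i * e i = 0\<rbrakk>
      \<Longrightarrow> (\<Sum>i<n. e i * b i) = 0"
  shows "\<exists>w. \<exists>p\<in>poly_lt k.
    (\<forall>i<n. P i p + (LINT x|\<mu>. K i x * ((1 / \<alpha>) * (\<Sum>j<n. w j * K j x))) + \<theta> i * w i = b i) \<and>
    (\<forall>q\<in>poly_lt k. (\<Sum>i<n. w i * P i q) = 0)"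
proof -
  define G where "G = (\<lambda>i j. LINT x|\<mu>. K i x * K j x)"
  have G_sum: "(LINT x|\<mu>. K i x * ((1 / \<alpha>) * (\<Sum>j<n. e j * K j x))) = (1 / \<alpha>) * (\<Sum>j<n. e j * G i j)" for e i
  proof -
    have "(LINT x|\<mu>. K i x * ((1 / \<alpha>) * (\<Sum>j<n. e j * K j x)))
        = (LINT x|\<mu>. (1 / \<alpha>) * ((\<Sum>j<n. e j * K j x) * K i x))"
      by (simp add: mult_ac)
    also have "\<dots> = (1 / \<alpha>) * (\<Sum>j<n. e j * (LINT x|\<mu>. K j x * K i x))"
      using L2_01_integral_sum_left[of "{..<n}" K "K i" e] K by simp
    finally show ?thesis by (simp add: G_def mult.commute)
  qed
  define V where "V = {(e :: nat \<Rightarrow> real, q). q \<in> poly_lt k}"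
  \<comment> \<open>Rows \<open>i < n\<close> are the equations; row \<open>n + j\<close> pairs the
    multipliers with the monomial of degree \<open>j\<close>. Since the Gram matrix \<open>G\<close>
    is symmetric, so is the whole system, and writing the right-hand side \<open>l\<close> as a
    combination of rows amounts to solving it.\<close>
  define L where "L = (\<lambda>i (e, q). if i < n
      then P i q + (1 / \<alpha>) * (\<Sum>j<n. e j * G i j) + \<theta> i * e i
      else (\<Sum>j<n. e j * P j (monom 1 (i - n))))"
  define l where "l = (\<lambda>(e :: nat \<Rightarrow> real, q :: real poly). \<Sum>i<n. e i * b i)"
  have "\<exists>d. \<forall>x\<in>V. l x = (\<Sum>i<n+k. d i * L i x)"
  proof (rule functional_in_span_of_kernels)
    fix x y a assume "x \<in> V" "y \<in> V"
    then obtain e q e' q' where x: "x = (e, q)" "q \<in> poly_lt k" and y: "y = (e', q')" "q' \<in> poly_lt k"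
      by (auto simp: V_def)
    show "\<exists>z\<in>V. l z = l x + a * l y \<and> (\<forall>i<n+k. L i z = L i x + a * L i y)"
      by (rule bexI[of _ "(\<lambda>i. e i + a * e' i, q + smult a q')"])
         (use x y poly_lt_add_smult in \<open>auto simp: V_def L_def l_def lin sum.distrib
            sum_distrib_left algebra_simps\<close>)
  next
    fix x assume "x \<in> V" and z: "\<forall>i<n+k. L i x = 0"
    then obtain e q where x: "x = (e, q)" "q \<in> poly_lt k" by (auto simp: V_def)
    have orth: "(\<Sum>i<n. e i * P i p) = 0" if "p \<in> poly_lt k" for p
    proof -
      have "(\<Sum>i<n. e i * P i (monom 1 j)) = 0" if "j < k" for j
        using z[rule_format, of "n + j"] that by (simp add: L_def x)
      then have "(\<Sum>j<k. coeff p j * (\<Sum>i<n. e i * P i (monom 1 j))) = 0" by simp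
      moreover have "P i p = (\<Sum>j<k. coeff p j * P i (monom 1 j))" for i
        using linear_poly_lt_sum[of "P i", OF lin] poly_lt_eq_sum_monom[OF that] by metis
      ultimately show ?thesis
        by (simp add: sum_distrib_left sum.swap[of _ "{..<n}"] mult_ac)
    qed
    define g where "g = (\<lambda>x. \<Sum>j<n. e j * K j x)"
    have g: "g \<in> L2_01" unfolding g_def by (intro L2_01_sum L2_01_cmult K)
    have "(LINT x|\<mu>. (g x)\<^sup>2) = (\<Sum>i<n. e i * (\<Sum>j<n. e j * G i j))"
    proof -
      have "(LINT x|\<mu>. (g x)\<^sup>2) = (\<Sum>i<n. e i * (LINT x|\<mu>. K i x * g x))"
        using L2_01_integral_sum_left[of "{..<n}" K g e] K g by (simp add: g_def power2_eq_square)
      moreover have "(LINT x|\<mu>. K i x * g x) = (\<Sum>j<n. e j * G i j)" for i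
        using L2_01_integral_sum_left[of "{..<n}" K "K i" e] K
        by (simp add: g_def G_def mult.commute)
      ultimately show ?thesis by simp
    qed
    \<comment> \<open>Pairing the first \<open>n\<close> rows with \<open>e\<close> removes the
      polynomial term by \<open>orth\<close>. The remaining non-negative terms must vanish, which
      gives the hypothesis of \<open>ker\<close>.\<close>
    then have "(1 / \<alpha>) * (LINT x|\<mu>. (g x)\<^sup>2) + (\<Sum>i<n. \<theta> i * (e i)\<^sup>2)
        = (\<Sum>i<n. e i * (P i q + (1 / \<alpha>) * (\<Sum>j<n. e j * G i j) + \<theta> i * e i)) - (\<Sum>i<n. e i * P i q)"
      by (simp add: sum.distrib sum_distrib_left algebra_simps power2_eq_square)
    also have "\<dots> = 0"
    proof -
      have "P i q + (1 / \<alpha>) * (\<Sum>j<n. e j * G i j) + \<theta> i * e i = 0" if "i < n" for i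
        using z[rule_format, of i] that by (simp add: L_def x)
      then show ?thesis using orth[OF x(2)] by simp
    qed
    finally have "(1 / \<alpha>) * (LINT x|\<mu>. (g x)\<^sup>2) + (\<Sum>i<n. \<theta> i * (e i)\<^sup>2) = 0" .
    moreover have "(1 / \<alpha>) * (LINT x|\<mu>. (g x)\<^sup>2) \<ge> 0" using \<alpha> by simp
    moreover have nn: "(\<Sum>i<n. \<theta> i * (e i)\<^sup>2) \<ge> 0" using \<theta> by (intro sum_nonneg) simp
    ultimately have "(\<Sum>i<n. \<theta> i * (e i)\<^sup>2) = 0" by linarith
    then have "\<theta> i * (e i)\<^sup>2 = 0" if "i < n" for i
      using \<theta> that by (subst (asm) sum_nonneg_eq_0_iff) auto
    then have "\<theta> i * e i = 0" if "i < n" for i using that by auto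
    then show "l x = 0" using ker[OF orth] by (simp add: l_def x)
  qed
  then obtain d where d: "\<And>x. x \<in> V \<Longrightarrow> l x = (\<Sum>i<n+k. d i * L i x)" by blast
  have split: "(\<Sum>i<n+k. h i) = (\<Sum>i<n. h i) + (\<Sum>j<k. h (n + j))" for h :: "nat \<Rightarrow> real"
    by (induction k) auto
  \<comment> \<open>The coefficients of the monomial rows are those of the polynomial; the first
    \<open>n\<close> entries of \<open>d\<close> are the multipliers.\<close>
  define p where "p = (\<Sum>j<k. smult (d (n + j)) (monom 1 j))"
  have p: "p \<in> poly_lt k" unfolding p_def by (rule sum_monom_poly_lt)
  have P0: "P i 0 = 0" for i using linear_poly_lt_sum[of "P i" "\<lambda>_. 0" "\<lambda>_. 0" 0, OF lin] by simp
  have "P i p + (1 / \<alpha>) * (\<Sum>j<n. d j * G i j) + \<theta> i * d i = b i" if i: "i < n" for i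
  proof -
    define \<delta> where "\<delta> = (\<lambda>j. if j = i then 1 else (0::real))"
    have \<delta>: "(\<Sum>j<n. \<delta> j * h j) = h i" for h
    proof -
      have "(\<Sum>j<n. \<delta> j * h j) = (\<Sum>j<n. if j = i then h j else 0)"
        by (rule sum.cong) (auto simp: \<delta>_def)
      then show ?thesis using i by simp
    qed
    \<comment> \<open>Evaluation at the \<open>i\<close>-th unit vector reads off column
      \<open>i\<close>, which by symmetry is equation \<open>i\<close>.\<close>
    have "b i = (\<Sum>m<n. d m * ((1 / \<alpha>) * G m i + \<theta> m * \<delta> m)) + (\<Sum>j<k. d (n + j) * P i (monom 1 j))"
      using d[of "(\<delta>, 0)"] by (simp add: V_def l_def split L_def P0 \<delta>)
    also have "(\<Sum>j<k. d (n + j) * P i (monom 1 j)) = P i p"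
      unfolding p_def by (rule linear_poly_lt_sum[symmetric, OF lin])
    also have "(\<Sum>m<n. d m * ((1 / \<alpha>) * G m i + \<theta> m * \<delta> m))
        = (1 / \<alpha>) * (\<Sum>m<n. d m * G m i) + (\<Sum>m<n. \<delta> m * (\<theta> m * d m))"
      by (simp add: sum.distrib sum_distrib_left algebra_simps)
    finally show ?thesis by (simp add: \<delta> G_def mult.commute)
  qed
  moreover have "(\<Sum>i<n. d i * P i q) = 0" if "q \<in> poly_lt k" for q
    using d[of "(\<lambda>_. 0, q)"] that by (simp add: V_def l_def split L_def)
  ultimately show ?thesis using p unfolding G_sum by blast
qed

section \<open>Existence and uniqueness\<close>

lemma sum_observation_split:
  fixes h :: "nat \<Rightarrow> real"
  shows "(\<Sum>i<M + 2. h i) = h 0 + (\<Sum>i=1..M. h i) + h (M + 1)"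
proof -
  have "(\<Sum>i<M + 2. h i) = (\<Sum>i<Suc M. h i) + h (M + 1)" by simp
  also have "(\<Sum>i<Suc M. h i) = h 0 + (\<Sum>i=1..M. h i)"
    unfolding lessThan_Suc_atMost atMost_atLeast0
    by (simp add: sum.atLeast_Suc_atMost)
  finally show ?thesis by simp
qed

lemma admissible_iff:
  assumes "k > 0"
  shows "f \<in> admissible k y \<longleftrightarrow> f \<in> extensional {0..1} \<and> f 0 = y 0 \<and> f 1 = y 1 \<and>
    (\<exists>p\<in>poly_lt k. \<exists>g\<in>L2_01. \<forall>x\<in>{0..1}. f x = poly_primitive k p g x)"
  unfolding admissible_def sobolev_01_iff[OF assms] by auto

lemma penalized_fit_has_unique_minimizer:
  assumes k: "k > 1" and M: "M > k" and \<alpha>: "\<alpha> > 0"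
  shows "\<exists>!f. f \<in> admissible k y \<and> (\<forall>g\<in>admissible k y. Phi k M \<alpha> Y f \<le> Phi k M \<alpha> Y g)"
proof -
  have k0: "k > 0" and M0: "M > 0" using k M by auto
  define P where "P = (\<lambda>i q. observation M i (poly q))"
  define b where "b = (\<lambda>i. if i = 0 then y 0 else if i \<le> M then Y i else y 1)"
  \<comment> \<open>The data term carries the factor \<open>1 / M\<close>, so stationarity makes the
    residual in cell \<open>i\<close> equal to \<open>M * w i\<close>. Weight 0 turns the two
    endpoint equations into exact constraints.\<close>
  define \<theta> where "\<theta> = (\<lambda>i. if 1 \<le> i \<and> i \<le> M then real M else 0)"
  have lin: "P i (p + smult c q) = P i p + c * P i q" for i p c q
    unfolding P_def by (rule observation_poly_linear)
  obtain K where K: "\<And>i. K i \<in> L2_01"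
    and obs: "\<And>i p g. g \<in> L2_01 \<Longrightarrow>
      observation M i (poly_primitive k p g) = P i p + (LINT x|\<mu>. K i x * g x)"
    using observation_poly_primitive[OF k0, of M] unfolding P_def by metis
  have obs': "observation M i f = P i p + (LINT x|\<mu>. K i x * g x)"
    if "g \<in> L2_01" "\<forall>x\<in>{0..1}. f x = poly_primitive k p g x" for f i p g
    using obs[OF that(1)] observation_cong[OF that(2) poly_primitive_continuous[OF k0 that(1)]] by simp
  have "\<exists>w. \<exists>p\<in>poly_lt k.
    (\<forall>i<M + 2. P i p + (LINT x|\<mu>. K i x * ((1 / \<alpha>) * (\<Sum>j<M + 2. w j * K j x))) + \<theta> i * w i = b i) \<and>
    (\<forall>q\<in>poly_lt k. (\<Sum>i<M + 2. w i * P i q) = 0)"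
  proof (rule saddle_point_system_solvable[OF \<alpha> K lin])
    show "\<theta> i \<ge> 0" for i by (simp add: \<theta>_def)
    fix e assume orth: "\<And>p. p \<in> poly_lt k \<Longrightarrow> (\<Sum>i<M + 2. e i * P i p) = 0"
      and z: "\<And>i. i < M + 2 \<Longrightarrow> \<theta> i * e i = 0"
    have inner: "e i = 0" if "i \<in> {1..M}" for i
      using z[of i] that M0 by (simp add: \<theta>_def)
    have ends: "e 0 * poly p 0 + e (M + 1) * poly p 1 = 0" if "p \<in> poly_lt k" for p
      using orth[OF that] inner unfolding sum_observation_split P_def observation_def by simp
    \<comment> \<open>Here \<open>k > 1\<close> enters: the polynomials 1 and x separate the two
      endpoint evaluations, so both remaining weights vanish.\<close>
    have "1 \<in> poly_lt k" "[:0, 1:] \<in> poly_lt k"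
      using k by (auto simp: poly_lt_def coeff_pCons coeff_1 split: nat.splits)
    then have "e 0 + e (M + 1) = 0" "e (M + 1) = 0"
      using ends[of 1] ends[of "[:0, 1:]"] by auto
    then show "(\<Sum>i<M + 2. e i * b i) = 0"
      using inner unfolding sum_observation_split by simp
  qed
  then obtain w p0 where p0: "p0 \<in> poly_lt k"
    and eqs: "\<And>i. i < M + 2 \<Longrightarrow>
      P i p0 + (LINT x|\<mu>. K i x * ((1 / \<alpha>) * (\<Sum>j<M + 2. w j * K j x))) + \<theta> i * w i = b i"
    and stat: "\<And>q. q \<in> poly_lt k \<Longrightarrow> (\<Sum>i<M + 2. w i * P i q) = 0"
    by blast
  define g0 where "g0 = (\<lambda>x. (1 / \<alpha>) * (\<Sum>j<M + 2. w j * K j x))"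
  have g0: "g0 \<in> L2_01" unfolding g0_def by (intro L2_01_sum L2_01_cmult K)
  \<comment> \<open>Restriction supplies the extensionality demanded by
    \<open>sobolev_01\<close>.\<close>
  define f0 where "f0 = restrict (poly_primitive k p0 g0) {0..1}"
  have f0: "\<forall>x\<in>{0..1}. f0 x = poly_primitive k p0 g0 x" by (simp add: f0_def)
  have obs0: "observation M i f0 + \<theta> i * w i = b i" if "i < M + 2" for i
    using eqs[OF that] obs'[OF g0 f0] by (simp add: g0_def)
  have f0_adm: "f0 \<in> admissible k y"
    unfolding admissible_iff[OF k0]
    using obs0[of 0] obs0[of "M + 1"] p0 g0 f0
    by (auto simp: observation_def \<theta>_def b_def f0_def)
  have Phi_eq: "Phi k M \<alpha> Y h = 1 / real M * (\<Sum>i=1..M. (Y i - observation M i h)\<^sup>2) + \<alpha> * (LINT x|\<mu>. (g x)\<^sup>2)"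
    if "p \<in> poly_lt k" "g \<in> L2_01" "\<forall>x\<in>{0..1}. h x = poly_primitive k p g x" for h p g
    using L2_norm_weak_deriv_poly_primitive[OF that]
    by (simp add: Phi_def observation_def)
  \<comment> \<open>An exact expansion of \<open>Phi\<close> at \<open>f0\<close> without linear
    term; minimality and uniqueness are both read off from it.\<close>
  have key: "\<exists>p g. p \<in> poly_lt k \<and> g \<in> L2_01 \<and> (\<forall>x\<in>{0..1}. h x = poly_primitive k p g x) \<and>
      Phi k M \<alpha> Y h = Phi k M \<alpha> Y f0
        + (1 / real M * (\<Sum>i=1..M. (observation M i h - observation M i f0)\<^sup>2)
           + \<alpha> * (LINT x|\<mu>. (g x - g0 x)\<^sup>2))"
    if h: "h \<in> admissible k y" for h
  proof -
    obtain p g where p: "p \<in> poly_lt k" and g: "g \<in> L2_01"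
      and hx: "\<forall>x\<in>{0..1}. h x = poly_primitive k p g x"
      using h unfolding admissible_iff[OF k0] by blast
    define D where "D = (\<lambda>i. observation M i h - observation M i f0)"
    have d: "(\<lambda>x. g x - g0 x) \<in> L2_01" using g g0 by auto
    have D_eq: "D i = P i (p + smult (-1) p0) + (LINT x|\<mu>. K i x * (g x - g0 x))" for i
    proof -
      have "(LINT x|\<mu>. K i x * (g x - g0 x)) = (LINT x|\<mu>. K i x * g x) - (LINT x|\<mu>. K i x * g0 x)"
        using L2_01_integrable_mult[OF K g] L2_01_integrable_mult[OF K g0]
        by (simp add: right_diff_distrib)
      then show ?thesis
        unfolding D_def obs'[OF g hx] obs'[OF g0 f0] lin by simp
    qed
    have ends: "D 0 = 0" "D (M + 1) = 0"
      using h f0_adm by (auto simp: D_def observation_def admissible_def)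
    \<comment> \<open>As \<open>D\<close> vanishes at both ends, the sum may run over all
      \<open>M + 2\<close> indices. Then \<open>stat\<close> removes the polynomial part, and the
      combination of the \<open>K i\<close> is \<open>\<alpha>\<close> times
      \<open>g0\<close>.\<close>
    have "(\<Sum>i=1..M. w i * D i) = (\<Sum>i<M + 2. w i * D i)"
      unfolding sum_observation_split ends by simp
    also have "\<dots> = (\<Sum>i<M + 2. w i * P i (p + smult (-1) p0))
        + (\<Sum>i<M + 2. w i * (LINT x|\<mu>. K i x * (g x - g0 x)))"
      by (simp only: D_eq distrib_left sum.distrib)
    also have "\<dots> = (\<Sum>i<M + 2. w i * (LINT x|\<mu>. K i x * (g x - g0 x)))"
      unfolding stat[OF poly_lt_add_smult[OF p p0]] by (rule add_0)
    also have "\<dots> = (LINT x|\<mu>. (\<Sum>i<M + 2. w i * K i x) * (g x - g0 x))"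
      by (rule L2_01_integral_sum_left[symmetric]) (use K d in auto)
    also have "\<dots> = (LINT x|\<mu>. \<alpha> * (g0 x * (g x - g0 x)))"
      using \<alpha> by (simp add: g0_def)
    finally have cross: "(\<Sum>i=1..M. w i * D i) = \<alpha> * (LINT x|\<mu>. g0 x * (g x - g0 x))"
      by simp
    have "(\<Sum>i=1..M. (Y i - observation M i h)\<^sup>2)
        = (\<Sum>i=1..M. (Y i - observation M i f0)\<^sup>2 - 2 * real M * (w i * D i) + (D i)\<^sup>2)"
    proof (rule sum.cong[OF refl])
      fix i assume "i \<in> {1..M}"
      \<comment> \<open>With this residual the linear part of the data term is a multiple of the
        left side of \<open>cross\<close>, so it cancels against the linear part of the
        penalty.\<close>
      then have r0: "Y i - observation M i f0 = real M * w i"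
        using obs0[of i] by (simp add: b_def \<theta>_def)
      have rh: "Y i - observation M i h = (Y i - observation M i f0) - D i" by (simp add: D_def)
      show "(Y i - observation M i h)\<^sup>2
          = (Y i - observation M i f0)\<^sup>2 - 2 * real M * (w i * D i) + (D i)\<^sup>2"
        unfolding rh r0 by (simp add: power2_eq_square algebra_simps)
    qed
    also have "\<dots> = (\<Sum>i=1..M. (Y i - observation M i f0)\<^sup>2) - 2 * real M * (\<Sum>i=1..M. w i * D i)
        + (\<Sum>i=1..M. (D i)\<^sup>2)"
      by (simp add: sum.distrib sum_subtractf sum_distrib_left)
    finally have data: "1 / real M * (\<Sum>i=1..M. (Y i - observation M i h)\<^sup>2)
        = 1 / real M * (\<Sum>i=1..M. (Y i - observation M i f0)\<^sup>2)
          - 2 * (\<alpha> * (LINT x|\<mu>. g0 x * (g x - g0 x))) + 1 / real M * (\<Sum>i=1..M. (D i)\<^sup>2)"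
      using M0 unfolding cross by (simp add: field_simps)
    have "(LINT x|\<mu>. (g x)\<^sup>2)
        = (LINT x|\<mu>. (g0 x)\<^sup>2 + 2 * (g0 x * (g x - g0 x)) + (g x - g0 x)\<^sup>2)"
      by (intro Bochner_Integration.integral_cong) (auto simp: power2_eq_square algebra_simps)
    also have "\<dots> = (LINT x|\<mu>. (g0 x)\<^sup>2) + 2 * (LINT x|\<mu>. g0 x * (g x - g0 x)) + (LINT x|\<mu>. (g x - g0 x)\<^sup>2)"
      using L2_01_square[OF g0] L2_01_integrable_mult[OF g0 d] L2_01_square[OF d] by simp
    finally have "\<alpha> * (LINT x|\<mu>. (g x)\<^sup>2) = \<alpha> * (LINT x|\<mu>. (g0 x)\<^sup>2)
        + 2 * (\<alpha> * (LINT x|\<mu>. g0 x * (g x - g0 x))) + \<alpha> * (LINT x|\<mu>. (g x - g0 x)\<^sup>2)"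
      by (simp add: algebra_simps)
    then have "Phi k M \<alpha> Y h = Phi k M \<alpha> Y f0
        + (1 / real M * (\<Sum>i=1..M. (D i)\<^sup>2) + \<alpha> * (LINT x|\<mu>. (g x - g0 x)\<^sup>2))"
      unfolding Phi_eq[OF p g hx] Phi_eq[OF p0 g0 f0] using data by linarith
    then show ?thesis using p g hx unfolding D_def by blast
  qed
  show ?thesis
  proof (intro ex1I[of _ f0] conjI ballI f0_adm)
    fix h assume "h \<in> admissible k y"
    from key[OF this] obtain g where
      "Phi k M \<alpha> Y h = Phi k M \<alpha> Y f0
        + (1 / real M * (\<Sum>i=1..M. (observation M i h - observation M i f0)\<^sup>2)
           + \<alpha> * (LINT x|\<mu>. (g x - g0 x)\<^sup>2))" by blast
    moreover have "1 / real M * (\<Sum>i=1..M. (observation M i h - observation M i f0)\<^sup>2) \<ge> 0"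
      "\<alpha> * (LINT x|\<mu>. (g x - g0 x)\<^sup>2) \<ge> 0"
      using \<alpha> by (simp_all add: sum_nonneg)
    ultimately show "Phi k M \<alpha> Y f0 \<le> Phi k M \<alpha> Y h" by linarith
  next
    fix h assume h: "h \<in> admissible k y \<and> (\<forall>g\<in>admissible k y. Phi k M \<alpha> Y h \<le> Phi k M \<alpha> Y g)"
    from key[OF conjunct1[OF h]] obtain p g where p: "p \<in> poly_lt k" and g: "g \<in> L2_01"
      and hx: "\<forall>x\<in>{0..1}. h x = poly_primitive k p g x"
      and eq: "Phi k M \<alpha> Y h = Phi k M \<alpha> Y f0
        + (1 / real M * (\<Sum>i=1..M. (observation M i h - observation M i f0)\<^sup>2)
           + \<alpha> * (LINT x|\<mu>. (g x - g0 x)\<^sup>2))" by blast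
    define d where "d = (\<lambda>x. g x - g0 x)"
    have d: "d \<in> L2_01" unfolding d_def using g g0 by auto
    have le: "Phi k M \<alpha> Y h \<le> Phi k M \<alpha> Y f0" using h f0_adm by blast
    have n1: "1 / real M * (\<Sum>i=1..M. (observation M i h - observation M i f0)\<^sup>2) \<ge> 0"
      and n2: "\<alpha> * (LINT x|\<mu>. (d x)\<^sup>2) \<ge> 0"
      using \<alpha> by (simp_all add: sum_nonneg)
    have "1 / real M * (\<Sum>i=1..M. (observation M i h - observation M i f0)\<^sup>2) = 0"
      and z2: "\<alpha> * (LINT x|\<mu>. (d x)\<^sup>2) = 0"
      using eq le n1 n2 unfolding d_def by linarith+
    then have "(\<Sum>i=1..M. (observation M i h - observation M i f0)\<^sup>2) = 0" using M0 by simp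
    then have same: "observation M i h = observation M i f0" if "i \<in> {1..M}" for i
      using that by (subst (asm) sum_nonneg_eq_0_iff) auto
    have d0: "AE x in \<mu>. d x = 0"
      by (rule L2_01_square_integral_zero[OF d]) (use z2 \<alpha> in simp)
    define q where "q = p + smult (-1) p0"
    have q: "q \<in> poly_lt k" unfolding q_def by (rule poly_lt_add_smult[OF p p0])
    \<comment> \<open>Since \<open>d\<close> vanishes almost everywhere, the iterated primitives of
      \<open>g\<close> and \<open>g0\<close> agree at every point and only a polynomial is
      left.\<close>
    have diff: "h x - f0 x = poly q x" if "x \<in> {0..1}" for x
    proof -
      have "h x - f0 x = poly q x + ((primitive_01 ^^ k) g x - (primitive_01 ^^ k) g0 x)"
        using hx f0 that by (simp add: poly_primitive_def q_def)
      also have "(primitive_01 ^^ k) g x - (primitive_01 ^^ k) g0 x = (primitive_01 ^^ k) d x"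
        using primitive_01_funpow_linear[OF g g0, of k "-1"] by (simp add: d_def)
      also have "\<dots> = 0" using primitive_01_funpow_zero[OF d d0 k0] by simp
      finally show ?thesis by simp
    qed
    have "q = 0"
    proof (rule poly_zero_if_cell_averages_zero[OF q _ M0])
      fix i assume i: "1 \<le> i" "i \<le> M"
      have "(LINT x|\<mu>. K i x * g x) = (LINT x|\<mu>. K i x * g0 x)"
      proof (rule integral_cong_AE)
        show "AE x in \<mu>. K i x * g x = K i x * g0 x"
          using d0 by eventually_elim (simp add: d_def)
      qed (intro borel_measurable_times L2_01_measurable K g g0)+
      then have "P i q = 0"
        using same[of i] i unfolding q_def lin obs'[OF g hx] obs'[OF g0 f0] by simp
      then show "cell_average M (poly q) i = 0" using i by (simp add: P_def observation_def)
    qed (use M in simp)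
    then have "h x = f0 x" if "x \<in> {0..1}" for x using diff[OF that] by simp
    then show "h = f0"
      using h f0_adm unfolding admissible_iff[OF k0] by (metis extensionalityI)
  qed
qed

text \<open>At a fixed outcome the group averages are real numbers, so the deterministic result
  applies.\<close>

theorem theorem3p1:
  fixes k M N :: nat and \<alpha> \<sigma> :: real and y :: "real \<Rightarrow> real"
    and \<Omega> :: "'w measure" and \<eta> :: "nat \<Rightarrow> 'w \<Rightarrow> real" and \<omega> :: 'w
    and Y :: "nat \<Rightarrow> real"
  assumes "k > 1" and "M > k" and "N > k" and "\<alpha> > 0" and "\<sigma> \<ge> 0"
    and "prob_space \<Omega>"
    and "\<And>j. j \<in> {1..<M * N} \<Longrightarrow> \<eta> j \<in> borel_measurable \<Omega>"
    and "\<And>j. j \<in> {1..<M * N} \<Longrightarrow> distr \<Omega> borel (\<eta> j) = centered_normal \<sigma>"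
    and "\<omega> \<in> space \<Omega>"
    and "noisy_sample M N y (\<lambda>j. \<eta> j \<omega>) 0 = y 0"
    and "noisy_sample M N y (\<lambda>j. \<eta> j \<omega>) (M * N) = y 1"
    and "Y = group_average N (noisy_sample M N y (\<lambda>j. \<eta> j \<omega>))"
  shows "\<exists>!f. f \<in> admissible k y \<and> (\<forall>g\<in>admissible k y. Phi k M \<alpha> Y f \<le> Phi k M \<alpha> Y g)"
  using penalized_fit_has_unique_minimizer[OF \<open>k > 1\<close> \<open>M > k\<close> \<open>\<alpha> > 0\<close>] .

end
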